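(* For $\alpha>0$ let $$g(\alpha)=\min_{u\ge 0}\left(\sqrt{(u^2+1)\,\mathrm{erfc}\!\left(u/\sqrt{2}\right)-\sqrt{2/\pi}\,u\,e^{-u^2/2}}+\alpha u\right).$$ Let $H$ be an $n\times m$ random matrix ($m<n$) with i.i.d. standard Gaussian $N(0,1)$ entries. Given $\delta=\frac{m}{n}$, let $\alpha^*$ be the largest $\alpha$ such that $g(\alpha)<\sqrt{1-\delta}$. Let $S=\{\mathbf{w}\in S^{n-1}:\|\mathbf{w}\|_1<\alpha^*\sqrt{n}\,\|\mathbf{w}\|_2\}$ and $w(S)=E\left(\sup_{\mathbf{w}\in S}\mathbf{h}^T\mathbf{w}\right)$, where $\mathbf{h}$ is a random vector in $\mathbb{R}^n$ with i.i.d. $N(0,1)$ components. Then, as $n$ goes to infinity (with $m/n=\delta$), $$w(S)\le g(\alpha^* )\sqrt{n}<\sqrt{n-m}-\frac{1}{2\sqrt{n-m}},$$ and with high probability $$\|\mathbf{w}\|_1\ge\alpha^*\sqrt{n}\,\|\mathbf{w}\|_2$$ holds for every vector $\mathbf{w}$ in the subspace generated by $H$.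
   Context: The subspace generated by $H$ is its column space $\{H\mathbf{u}:\mathbf{u}\in\mathbb{R}^m\}\subseteq\mathbb{R}^n$. $S^{n-1}$ is the unit Euclidean sphere in $\mathbb{R}^n$. $\mathrm{erfc}(t)=\frac{2}{\sqrt{\pi}}\int_t^\infty e^{-s^2}\,ds$ is the complementary error function. "With high probability" is with respect to the random subspace generated by $H$, as $n\to\infty$ with $m/n=\delta$ fixed.
   Formalization: No largest α with g(α)<√(1−δ) exists (these α form an open interval), so α* is taken as the supremum; w(S)≤g(α* )√n is proved at α*, while the strict inequality and the high-probability bound are proved for every α>0 with g(α)<√(1−δ), i.e. every 0<α<α*. *)

theory Defs
  imports "HOL-Probability.Probability"
begin

definition erfc :: "real \<Rightarrow> real" where
  "erfc t = 2 / sqrt pi * (LBINT s:{t..}. exp (- s\<^sup>2))"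

definition g_obj :: "real \<Rightarrow> real \<Rightarrow> real" where
  "g_obj \<alpha> u =
     sqrt ((u\<^sup>2 + 1) * erfc (u / sqrt 2) - sqrt (2 / pi) * u * exp (- u\<^sup>2 / 2)) + \<alpha> * u"

(* For \<alpha> > 0 the infimum is attained, see g_fun_minimum below; at \<alpha> = 0 it would not be. *)
definition g_fun :: "real \<Rightarrow> real" where
  "g_fun \<alpha> = (INF u\<in>{0..}. g_obj \<alpha> u)"

(* "The largest \<alpha> with g_fun \<alpha> < sqrt (1 - \<delta>)" can only be read as a supremum: g_fun is
   continuous and nondecreasing on \<alpha> > 0, so these \<alpha> form an open interval, and at its right
   end point g_fun \<alpha> = sqrt (1 - \<delta>). There the strict bound
   g_fun \<alpha> * sqrt n < sqrt (n - m) - 1 / (2 * sqrt (n - m)) fails, so claims that rest on it have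
   to be made for every \<alpha> satisfying the strict inequality, i.e. arbitrarily close to alpha_star. *)
definition alpha_star :: "real \<Rightarrow> real" where
  "alpha_star \<delta> = Sup {\<alpha>. 0 < \<alpha> \<and> g_fun \<alpha> < sqrt (1 - \<delta>)}"

(* Vectors of R^n are the functions on {..<n}, extended by undefined: the space of a
   product measure indexed by {..<n}. Their Euclidean norm is L2_set w {..<n}. *)
definition l1_norm :: "nat \<Rightarrow> (nat \<Rightarrow> real) \<Rightarrow> real" where
  "l1_norm n w = (\<Sum>i<n. \<bar>w i\<bar>)"

definition unit_sphere :: "nat \<Rightarrow> (nat \<Rightarrow> real) set" where
  "unit_sphere n = {w \<in> {..<n} \<rightarrow>\<^sub>E UNIV. L2_set w {..<n} = 1}"

definition S_set :: "nat \<Rightarrow> real \<Rightarrow> (nat \<Rightarrow> real) set" where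
  "S_set n \<alpha> = {w \<in> unit_sphere n. l1_norm n w < \<alpha> * sqrt (real n) * L2_set w {..<n}}"

definition std_gaussian :: "nat \<Rightarrow> (nat \<Rightarrow> real) measure" where
  "std_gaussian n = (\<Pi>\<^sub>M i\<in>{..<n}. density lborel std_normal_density)"

definition gaussian_width :: "nat \<Rightarrow> (nat \<Rightarrow> real) set \<Rightarrow> real" where
  "gaussian_width n T = (LINT h|std_gaussian n. (SUP w\<in>T. \<Sum>i<n. h i * w i))"

definition column_space :: "nat \<Rightarrow> nat \<Rightarrow> (nat \<times> nat \<Rightarrow> real) \<Rightarrow> (nat \<Rightarrow> real) set" where
  "column_space n m A = range (\<lambda>u :: nat \<Rightarrow> real. \<lambda>i\<in>{..<n}. \<Sum>j<m. A (i, j) * u j)"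

definition gaussian_matrix ::
    "'a measure \<Rightarrow> nat \<Rightarrow> nat \<Rightarrow> (nat \<times> nat \<Rightarrow> 'a \<Rightarrow> real) \<Rightarrow> bool" where
  "gaussian_matrix M n m H \<longleftrightarrow>
     prob_space M \<and>
     prob_space.indep_vars M (\<lambda>_. borel) H ({..<n} \<times> {..<m}) \<and>
     (\<forall>p\<in>{..<n} \<times> {..<m}. distributed M lborel (H p) std_normal_density)"

lemma erfc_integrable: "integrable lborel (\<lambda>s::real. exp (- s\<^sup>2))"
proof -
  have "integrable lborel (\<lambda>s. sqrt pi * normal_density 0 (1 / sqrt 2) s)"
    by (intro integrable_mult_right integrable_normal_density) auto
  also have "(\<lambda>s. sqrt pi * normal_density 0 (1 / sqrt 2) s) = (\<lambda>s. exp (- s\<^sup>2))"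
    by (auto simp: normal_density_def power_divide real_sqrt_mult)
  finally show ?thesis .
qed

lemma erfc_set_integrable:
  assumes "A \<in> sets borel"
  shows "set_integrable lborel A (\<lambda>s::real. exp (- s\<^sup>2))"
  using integrable_mult_indicator[OF _ erfc_integrable, of A] assms
  unfolding set_integrable_def by simp

lemma erfc_nonneg: "0 \<le> erfc t"
  unfolding erfc_def set_lebesgue_integral_def by (auto intro!: mult_nonneg_nonneg integral_nonneg)

lemma erfc_split:
  assumes "0 \<le> t"
  shows "erfc t = erfc 0 - 2 / sqrt pi * integral {0..t} (\<lambda>s. exp (- s\<^sup>2))"
proof -
  have "{0::real..} = {0..<t} \<union> {t..}" using assms by auto
  moreover have "(LBINT s:{0..<t} \<union> {t..}. exp (- s\<^sup>2)) =
      (LBINT s:{0..<t}. exp (- s\<^sup>2)) + (LBINT s:{t..}. exp (- s\<^sup>2))"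
    by (intro set_integral_Un erfc_set_integrable) auto
  moreover have "(LBINT s:{0..<t}. exp (- s\<^sup>2)) = integral {0..<t} (\<lambda>s. exp (- s\<^sup>2))"
    by (intro set_borel_integral_eq_integral(2) erfc_set_integrable) auto
  moreover have "integral {0..<t} (\<lambda>s::real. exp (- s\<^sup>2)) = integral {0..t} (\<lambda>s. exp (- s\<^sup>2))"
    by (rule integral_subset_negligible) (auto intro!: negligible_subset[OF negligible_sing[of t]])
  ultimately have "(LBINT s:{0..}. exp (- s\<^sup>2)) =
      integral {0..t} (\<lambda>s. exp (- s\<^sup>2)) + (LBINT s:{t..}. exp (- s\<^sup>2))"
    by metis
  then show ?thesis unfolding erfc_def by (metis add_diff_cancel_left' right_diff_distrib)
qed

lemma continuous_on_erfc: "continuous_on {0..} erfc"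
proof -
  have "continuous_on {0..b} (\<lambda>t. integral {0..t} (\<lambda>s::real. exp (- s\<^sup>2)))" for b
    by (intro indefinite_integral_continuous_1 integrable_continuous_real continuous_intros)
  then have *: "continuous_on {0..b} erfc" for b
    by (subst continuous_on_cong[OF refl erfc_split]) (auto intro!: continuous_intros)
  have "continuous (at t within {0..}) erfc" if t: "0 \<le> t" for t
  proof -
    have "continuous (at t within {0..t + 1}) erfc"
      using * t by (simp add: continuous_on_eq_continuous_within)
    moreover have "at t within {0..t + 1} = at t within {0..}"
      by (rule at_within_nhd[of _ "{..<t + 1}"]) auto
    ultimately show ?thesis by simp
  qed
  then show ?thesis by (simp add: continuous_on_eq_continuous_within)
qed

lemma continuous_on_g_obj: "continuous_on {0..} (g_obj \<alpha>)"
  unfolding g_obj_def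
  by (intro continuous_intros continuous_on_compose2[OF continuous_on_erfc]) auto

lemma g_obj_lower:
  assumes "0 \<le> u"
  shows "g_obj \<alpha> u \<ge> \<alpha> * u - 1"
proof -
  have "u \<le> exp (u\<^sup>2 / 2)"
  proof -
    have "2 * u \<le> 2 + u\<^sup>2" using sum_squares_bound[of 1 u] by (simp add: power2_eq_square)
    then show ?thesis using exp_ge_add_one_self[of "u\<^sup>2 / 2"] by linarith
  qed
  then have "u * exp (- u\<^sup>2 / 2) \<le> exp (u\<^sup>2 / 2) * exp (- u\<^sup>2 / 2)"
    by (intro mult_right_mono) auto
  then have "u * exp (- u\<^sup>2 / 2) \<le> 1" by (simp flip: exp_add)
  moreover have "sqrt (2 / pi) \<le> 1" using pi_gt3 by simp
  ultimately have "sqrt (2 / pi) * (u * exp (- u\<^sup>2 / 2)) \<le> 1"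
    using mult_mono[of "sqrt (2 / pi)" 1 "u * exp (- u\<^sup>2 / 2)" 1] assms by simp
  moreover have "0 \<le> (u\<^sup>2 + 1) * erfc (u / sqrt 2)" by (simp add: erfc_nonneg)
  ultimately have "-1 \<le> (u\<^sup>2 + 1) * erfc (u / sqrt 2) - sqrt (2 / pi) * u * exp (- u\<^sup>2 / 2)"
    by (simp add: mult.assoc)
  from real_sqrt_le_mono[OF this] show ?thesis
    unfolding g_obj_def by (simp add: real_sqrt_minus)
qed

lemma g_fun_minimum:
  assumes "0 < \<alpha>"
  obtains u where "0 \<le> u" "g_fun \<alpha> = g_obj \<alpha> u" "\<And>v. 0 \<le> v \<Longrightarrow> g_obj \<alpha> u \<le> g_obj \<alpha> v"
proof -
  define B where "B = max 0 ((g_obj \<alpha> 0 + 1) / \<alpha>)"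
  have "continuous_on {0..B} (g_obj \<alpha>)"
    by (rule continuous_on_subset[OF continuous_on_g_obj]) auto
  moreover have "{0..B} \<noteq> {}" by (simp add: B_def)
  ultimately obtain u where u: "u \<in> {0..B}" "\<And>v. v \<in> {0..B} \<Longrightarrow> g_obj \<alpha> u \<le> g_obj \<alpha> v"
    using continuous_attains_inf[of "{0..B}" "g_obj \<alpha>"] by auto
  have min: "g_obj \<alpha> u \<le> g_obj \<alpha> v" if v: "0 \<le> v" for v
  proof (cases "v \<le> B")
    case False
    then have "(g_obj \<alpha> 0 + 1) / \<alpha> < v" by (simp add: B_def)
    then have "g_obj \<alpha> 0 + 1 < \<alpha> * v" using assms by (simp add: field_simps)
    then have "g_obj \<alpha> 0 \<le> g_obj \<alpha> v" using g_obj_lower[OF v, of \<alpha>] by simp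
    moreover have "g_obj \<alpha> u \<le> g_obj \<alpha> 0" using u(2)[of 0] by (simp add: B_def)
    ultimately show ?thesis by simp
  qed (use u v in auto)
  have "g_fun \<alpha> = g_obj \<alpha> u"
    unfolding g_fun_def by (rule cInf_eq_minimum) (use u min in auto)
  then show ?thesis using that u(1) min by auto
qed

end

theory Submission
  imports Defs "HOL-Real_Asymp.Real_Asymp"
begin

text \<open>For a multiplier u, Lagrangian duality bounds h w on the cone C, where the l1 norm is less than
  \<alpha> sqrt n times the l2 norm, by |(|h| - u)+| + u \<alpha> sqrt n times the norm of w. Taking expectations and
  minimising over u gives the width bound. Whether the column space of H meets C is decided by Gordon's
  min-max comparison for the processes v H u + |u||v| z - v w and |v| (g u) + |u| (h v) - v w, with w
  ranging over C: it bounds the probability of a meeting by P(dist(h, C) \<le> |g| + c) + P(z \<ge> c).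
  By the same duality dist(h, C)^2 is at least |h|^2 - (|(|h| - u)+| + u \<alpha> sqrt n)^2. As |h|^2, |g|^2 and
  |(|h| - u)+|^2 are sums of independent variables, Chebyshev's inequality reduces dist(h, C) > |g| + c
  with small c / sqrt n to 1 - g(\<alpha>)^2 > \<delta>, and no concentration of measure is needed.\<close>

section \<open>Test functions with sign-constrained second derivatives\<close>

text \<open>A vector \<open>H u\<close> equals a cone vector w iff v (H u - w) \<le> 0 for all v. So
  the pair (u, w) is the outer index of the min-max event and v the inner one; the deterministic
  shift v w belongs to the thresholds, not to the Gaussian processes. The term |u||v| z makes the
  covariances agree whenever the outer index is the same, which is where the comparison needs
  equality. The escape probability is not deduced from the bound on the width: both are consequences
  of the same dual estimate with the multiplier u that attains \<open>g_fun\<close>. For \<alpha>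
  below \<open>alpha_star\<close> the distance from h to the cone exceeds |g| by a fixed multiple of
  sqrt n, while norms of Gaussian vectors fluctuate much less; second moments therefore suffice, and
  every exceptional probability is of order 1/n. A min-max over spheres would involve uncountable
  suprema. As the cone is open, countable families of rational vectors, not normalised, approximate
  all that matters, and the comparison passes from finite to countable index sets by monotone
  limits.\<close>

definition bcont :: "(('p::countable \<Rightarrow> real) \<Rightarrow> real) \<Rightarrow> bool" where
  "bcont F \<longleftrightarrow> continuous_on UNIV F \<and> (\<exists>B. \<forall>x. \<bar>F x\<bar> \<le> B)"

text \<open>Differentiability is tested along curves because the arguments live in a product space
  without a norm. Only two kinds of curves are needed: the interpolation path between the processes
  and the variation of one Gaussian coordinate. As the curves are arbitrary outside T, F can depend
  only on coordinates in T.\<close>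

definition has_grad ::
    "'p set \<Rightarrow> (('p \<Rightarrow> real) \<Rightarrow> real) \<Rightarrow> ('p \<Rightarrow> ('p \<Rightarrow> real) \<Rightarrow> real) \<Rightarrow> bool" where
  "has_grad T F D \<longleftrightarrow> (\<forall>\<gamma> \<gamma>' s. (\<forall>p\<in>T. (\<gamma> p has_real_derivative \<gamma>' p) (at s)) \<longrightarrow>
     ((\<lambda>t. F (\<lambda>p. \<gamma> p t)) has_real_derivative (\<Sum>p\<in>T. D p (\<lambda>p. \<gamma> p s) * \<gamma>' p)) (at s))"

lemma bcontE:
  assumes "bcont F"
  obtains B where "\<And>x. \<bar>F x\<bar> \<le> B" "B \<ge> 0"
proof -
  obtain B where B: "\<bar>F x\<bar> \<le> B" for x using assms by (auto simp: bcont_def)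
  moreover have "B \<ge> 0" using B[of undefined] by linarith
  ultimately show ?thesis using that by blast
qed

lemma bcont_borel: "bcont F \<Longrightarrow> F \<in> borel_measurable borel"
  unfolding bcont_def by (auto intro: borel_measurable_continuous_onI)

lemma bcont_const: "bcont (\<lambda>_. c)"
  by (auto simp: bcont_def)

lemma bcont_coordinate:
  assumes "continuous_on UNIV \<psi>" "\<And>t. \<bar>\<psi> t\<bar> \<le> B"
  shows "bcont (\<lambda>x. \<psi> (x p))"
proof -
  have "continuous_on UNIV (\<lambda>x. \<psi> (x p))"
    by (rule continuous_on_compose2[OF assms(1) continuous_on_product_coordinates]) auto
  then show ?thesis using assms(2) by (auto simp: bcont_def)
qed

lemma bcont_add:
  assumes "bcont F" "bcont G" shows "bcont (\<lambda>x. F x + G x)"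
proof -
  obtain B where "\<And>x. \<bar>F x\<bar> \<le> B" "B \<ge> 0" using bcontE[OF assms(1)] by blast
  moreover obtain C where "\<And>x. \<bar>G x\<bar> \<le> C" "C \<ge> 0" using bcontE[OF assms(2)] by blast
  ultimately have "\<bar>F x + G x\<bar> \<le> B + C" for x by (meson abs_triangle_ineq add_mono order_trans)
  then show ?thesis using assms by (auto simp: bcont_def intro!: continuous_on_add)
qed

lemma bcont_mult:
  assumes "bcont F" "bcont G" shows "bcont (\<lambda>x. F x * G x)"
proof -
  obtain B where "\<And>x. \<bar>F x\<bar> \<le> B" "B \<ge> 0" using bcontE[OF assms(1)] by blast
  moreover obtain C where "\<And>x. \<bar>G x\<bar> \<le> C" "C \<ge> 0" using bcontE[OF assms(2)] by blast
  ultimately have "\<bar>F x * G x\<bar> \<le> B * C" for x by (simp add: abs_mult mult_mono)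
  then show ?thesis using assms by (auto simp: bcont_def intro!: continuous_on_mult)
qed

lemma bcont_sum: "(\<And>i. i \<in> I \<Longrightarrow> bcont (F i)) \<Longrightarrow> bcont (\<lambda>x. \<Sum>i\<in>I. F i x)"
  by (induction I rule: infinite_finite_induct) (auto intro: bcont_const bcont_add)

lemma bcont_prod: "(\<And>i. i \<in> I \<Longrightarrow> bcont (F i)) \<Longrightarrow> bcont (\<lambda>x. \<Prod>i\<in>I. F i x)"
  by (induction I rule: infinite_finite_induct) (auto intro: bcont_const bcont_mult)

lemma bcont_uminus: "bcont F \<Longrightarrow> bcont (\<lambda>x. - F x)"
  using bcont_mult[OF bcont_const[of "-1"], of F] by simp

lemma bcont_diff: "bcont F \<Longrightarrow> bcont G \<Longrightarrow> bcont (\<lambda>x. F x - G x)"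
  using bcont_add[of F "\<lambda>x. - G x"] bcont_uminus[of G] by simp

lemma bcont_if: "bcont F \<Longrightarrow> bcont G \<Longrightarrow> bcont (\<lambda>x. if b then F x else G x)"
  by (cases b) auto

lemmas bcont_intros = bcont_const bcont_add bcont_mult bcont_sum bcont_prod bcont_uminus bcont_diff bcont_if

lemma has_gradD:
  assumes "has_grad T F D" "\<And>p. p \<in> T \<Longrightarrow> (\<gamma> p has_real_derivative \<gamma>' p) (at s)"
  shows "((\<lambda>t. F (\<lambda>p. \<gamma> p t)) has_real_derivative (\<Sum>p\<in>T. D p (\<lambda>p. \<gamma> p s) * \<gamma>' p)) (at s)"
  using assms unfolding has_grad_def by blast

lemma has_grad_coordinate:
  assumes "finite T" "p \<in> T" "\<And>t. (\<psi> has_real_derivative \<psi>' t) (at t)"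
  shows "has_grad T (\<lambda>x. \<psi> (x p)) (\<lambda>q x. if q = p then \<psi>' (x p) else 0)"
  unfolding has_grad_def
proof (intro allI impI)
  fix \<gamma> \<gamma>' :: "_ \<Rightarrow> _" and s
  assume "\<forall>p\<in>T. (\<gamma> p has_real_derivative \<gamma>' p) (at s)"
  then have "((\<lambda>t. \<psi> (\<gamma> p t)) has_real_derivative \<psi>' (\<gamma> p s) * \<gamma>' p) (at s)"
    by (intro DERIV_chain2[of \<psi>] assms) (use assms in auto)
  moreover have "(\<Sum>q\<in>T. (if q = p then \<psi>' (\<gamma> p s) else 0) * \<gamma>' q) = \<psi>' (\<gamma> p s) * \<gamma>' p"
    by (subst sum.remove[OF assms(1,2)]) auto
  ultimately show "((\<lambda>t. \<psi> (\<gamma> p t)) has_real_derivative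
      (\<Sum>q\<in>T. (if q = p then \<psi>' (\<gamma> p s) else 0) * \<gamma>' q)) (at s)" by simp
qed

lemma has_grad_mult:
  assumes "has_grad T F D" "has_grad T G E"
  shows "has_grad T (\<lambda>x. F x * G x) (\<lambda>p x. D p x * G x + F x * E p x)"
  unfolding has_grad_def
  by (auto intro!: DERIV_cong[OF DERIV_mult[OF has_gradD[OF assms(1)] has_gradD[OF assms(2)]]]
      simp: sum.distrib algebra_simps sum_distrib_left)

lemma has_grad_one_diff:
  assumes "has_grad T F D"
  shows "has_grad T (\<lambda>x. 1 - F x) (\<lambda>p x. - D p x)"
  unfolding has_grad_def
  by (auto intro!: DERIV_cong[OF DERIV_diff[OF DERIV_const has_gradD[OF assms(1)]]] simp: sum_negf)

lemma has_grad_uminus: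
  assumes "has_grad T F D"
  shows "has_grad T (\<lambda>x. - F x) (\<lambda>p x. - D p x)"
  unfolding has_grad_def
  by (auto intro!: DERIV_cong[OF DERIV_minus[OF has_gradD[OF assms(1)]]] simp: sum_negf)

lemma has_grad_prod:
  assumes "\<And>i. i \<in> I \<Longrightarrow> has_grad T (F i) (D i)"
  shows "has_grad T (\<lambda>x. \<Prod>i\<in>I. F i x) (\<lambda>p x. \<Sum>i\<in>I. D i p x * (\<Prod>j\<in>I - {i}. F j x))"
  unfolding has_grad_def
proof (intro allI impI)
  fix \<gamma> \<gamma>' :: "_ \<Rightarrow> _" and s
  assume *: "\<forall>p\<in>T. (\<gamma> p has_real_derivative \<gamma>' p) (at s)"
  have "((\<lambda>t. \<Prod>i\<in>I. F i (\<lambda>p. \<gamma> p t)) has_derivative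
      (\<lambda>y. \<Sum>i\<in>I. ((\<Sum>p\<in>T. D i p (\<lambda>p. \<gamma> p s) * \<gamma>' p) * y) * (\<Prod>j\<in>I - {i}. F j (\<lambda>p. \<gamma> p s)))) (at s)"
    using * assms by (intro has_derivative_prod has_field_derivative_imp_has_derivative) (auto intro: has_gradD)
  then show "((\<lambda>t. \<Prod>i\<in>I. F i (\<lambda>p. \<gamma> p t)) has_real_derivative
      (\<Sum>p\<in>T. (\<Sum>i\<in>I. D i p (\<lambda>p. \<gamma> p s) * (\<Prod>j\<in>I - {i}. F j (\<lambda>p. \<gamma> p s))) * \<gamma>' p)) (at s)"
    unfolding has_field_derivative_def
    by (rule has_derivative_eq_rhs)
       (auto simp: fun_eq_iff sum_distrib_left sum_distrib_right mult_ac intro!: sum.swap)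
qed

lemma has_grad_cong:
  assumes "has_grad T F D" "\<And>p x. p \<in> T \<Longrightarrow> D p x = D' p x"
  shows "has_grad T F D'"
  using assms by (auto simp: has_grad_def cong: sum.cong)

lemma sum_eq_single:
  fixes f :: "'b \<Rightarrow> 'c::comm_monoid_add"
  assumes "finite A" "a \<in> A" "\<And>x. x \<in> A \<Longrightarrow> x \<noteq> a \<Longrightarrow> f x = 0"
  shows "sum f A = f a"
  using assms by (subst sum.remove[OF assms(1,2)]) auto

text \<open>\<open>D\<close> and \<open>E\<close> are the first and second partial derivatives.
  Their boundedness is what integration by parts and the interchange of integrals rely on.\<close>

definition smooth_test where
  "smooth_test T F D E \<longleftrightarrow> bcont F \<and> (\<forall>p\<in>T. bcont (D p)) \<and> (\<forall>p\<in>T. \<forall>q\<in>T. bcont (E p q)) \<and>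
     has_grad T F D \<and> (\<forall>p\<in>T. has_grad T (D p) (E p))"

text \<open>A smoothed indicator of a min-max event. Its mixed second derivatives across different rows are
  nonnegative because every row factor increases in each of its coordinates; within a row the sign is
  irrelevant, as the covariances agree there.\<close>

lemma smooth_test_min_max:
  fixes U :: "'u::countable set" and V :: "'v::countable set"
    and \<psi> \<psi>' \<psi>'' :: "'u \<times> 'v \<Rightarrow> real \<Rightarrow> real"
  assumes fin: "finite U" "finite V"
    and d1: "\<And>p t. (\<psi> p has_real_derivative \<psi>' p t) (at t)"
    and d2: "\<And>p t. (\<psi>' p has_real_derivative \<psi>'' p t) (at t)"
    and c2: "\<And>p. continuous_on UNIV (\<psi>'' p)"
    and b0: "\<And>p t. 0 \<le> \<psi> p t" "\<And>p t. \<psi> p t \<le> 1"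
    and b1: "\<And>p t. \<psi>' p t \<le> 0" "\<And>p t. \<bar>\<psi>' p t\<bar> \<le> B"
    and b2: "\<And>p t. \<bar>\<psi>'' p t\<bar> \<le> B"
  obtains D E where
    "smooth_test (U \<times> V) (\<lambda>x. \<Prod>u\<in>U. 1 - (\<Prod>v\<in>V. \<psi> (u, v) (x (u, v)))) D E"
    "\<And>p q x. p \<in> U \<times> V \<Longrightarrow> q \<in> U \<times> V \<Longrightarrow> fst p \<noteq> fst q \<Longrightarrow> 0 \<le> E p q x"
proof -
  define T where "T = U \<times> V"
  have [simp]: "finite T" using fin by (simp add: T_def)
  have cont: "continuous_on UNIV (\<psi> p)" "continuous_on UNIV (\<psi>' p)" for p
    using DERIV_continuous_on[of UNIV "\<psi> p"] DERIV_continuous_on[of UNIV "\<psi>' p"] d1 d2 by blast+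
  have bc0: "bcont (\<lambda>x. \<psi> p (x p))" for p
    by (rule bcont_coordinate[where B = 1, OF cont(1)]) (use b0[of p] in \<open>auto simp: abs_le_iff intro: order_trans[of _ 0]\<close>)
  have bc1: "bcont (\<lambda>x. \<psi>' p (x p))" for p
    by (rule bcont_coordinate[where B = B]) (use b1 cont in auto)
  have bc2: "bcont (\<lambda>x. \<psi>'' p (x p))" for p
    by (rule bcont_coordinate[where B = B]) (use b2 c2 in auto)
  \<comment> \<open>\<open>f u\<close> is the factor of row u, \<open>G p\<close> its partial
    derivative in the coordinate p of that row, and \<open>d u\<close> its gradient, zero off the
    row. \<open>e p\<close> is the gradient of \<open>G p\<close>; \<open>D\<close> and
    \<open>E\<close> are the first and second derivatives of the product of the rows.\<close>
  define f where "f u x = 1 - (\<Prod>v\<in>V. \<psi> (u, v) (x (u, v)))" for u x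
  define G where "G p x = - \<psi>' p (x p) * (\<Prod>v\<in>V - {snd p}. \<psi> (fst p, v) (x (fst p, v)))" for p x
  define d where "d u p x = (if fst p = u then G p x else 0)" for u p x
  define D where "D p x = G p x * (\<Prod>u\<in>U - {fst p}. f u x)" for p x
  define e where "e p q x = - (if q = p then \<psi>'' p (x p) else 0) * (\<Prod>v\<in>V - {snd p}. \<psi> (fst p, v) (x (fst p, v)))
      + - \<psi>' p (x p) * (\<Sum>v\<in>V - {snd p}. (if q = (fst p, v) then \<psi>' (fst p, v) (x (fst p, v)) else 0) *
          (\<Prod>v'\<in>V - {snd p} - {v}. \<psi> (fst p, v') (x (fst p, v'))))" for p q x
  define E where "E p q x = e p q x * (\<Prod>u\<in>U - {fst p}. f u x) +
      G p x * (\<Sum>u\<in>U - {fst p}. d u q x * (\<Prod>u'\<in>U - {fst p} - {u}. f u' x))" for p q x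
  have f_grad: "has_grad T (f u) (d u)" if u: "u \<in> U" for u
  proof -
    have "has_grad T (f u) (\<lambda>p x. - (\<Sum>v\<in>V. (if p = (u, v) then \<psi>' (u, v) (x (u, v)) else 0) *
        (\<Prod>v'\<in>V - {v}. \<psi> (u, v') (x (u, v')))))"
      unfolding f_def using u
      by (intro has_grad_one_diff has_grad_prod has_grad_coordinate d1) (use fin in \<open>auto simp: T_def\<close>)
    then show ?thesis
    proof (rule has_grad_cong)
      fix p x assume p: "p \<in> T"
      show "- (\<Sum>v\<in>V. (if p = (u, v) then \<psi>' (u, v) (x (u, v)) else 0) *
          (\<Prod>v'\<in>V - {v}. \<psi> (u, v') (x (u, v')))) = d u p x"
      proof (cases "fst p = u")
        case True
        then show ?thesis using p fin
          by (subst sum_eq_single[of _ "snd p"]) (auto simp: T_def d_def G_def)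
      next
        case False
        then have "(\<Sum>v\<in>V. (if p = (u, v) then \<psi>' (u, v) (x (u, v)) else 0) *
          (\<Prod>v'\<in>V - {v}. \<psi> (u, v') (x (u, v')))) = 0"
          by (intro sum.neutral) auto
        then show ?thesis using False by (simp add: d_def)
      qed
    qed
  qed
  have F_grad: "has_grad T (\<lambda>x. \<Prod>u\<in>U. f u x) D"
  proof (rule has_grad_cong[OF has_grad_prod[of U T f d]])
    fix p x assume p: "p \<in> T"
    show "(\<Sum>i\<in>U. d i p x * (\<Prod>j\<in>U - {i}. f j x)) = D p x"
      using p fin by (subst sum_eq_single[of _ "fst p"]) (auto simp: T_def d_def D_def)
  qed (use f_grad in auto)
  have G_grad: "has_grad T (G p) (e p)" if p: "p \<in> T" for p
    unfolding G_def e_def using p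
    by (intro has_grad_mult has_grad_uminus has_grad_prod has_grad_coordinate d1 d2) (use fin in \<open>auto simp: T_def\<close>)
  have D_grad: "has_grad T (D p) (E p)" if p: "p \<in> T" for p
    unfolding D_def E_def using p by (intro has_grad_mult G_grad has_grad_prod f_grad) auto
  have bc_f: "bcont (f u)" for u unfolding f_def by (intro bcont_intros bc0)
  have bc_G: "bcont (G p)" for p unfolding G_def
    by (intro bcont_intros bc0 bc1)
  have bc_d: "bcont (d u p)" for u p unfolding d_def by (intro bcont_intros bc_G)
  have bc_e: "bcont (e p q)" for p q unfolding e_def
    by (intro bcont_intros bc0 bc1 bc2)
  have bc_D: "bcont (D p)" for p unfolding D_def by (intro bcont_intros bc_G bc_f)
  have bc_E: "bcont (E p q)" for p q unfolding E_def by (intro bcont_intros bc_G bc_f bc_d bc_e)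
  have bc_F: "bcont (\<lambda>x. \<Prod>u\<in>U. f u x)" by (intro bcont_intros bc_f)
  have "smooth_test T (\<lambda>x. \<Prod>u\<in>U. f u x) D E"
    using bc_D bc_E bc_F F_grad D_grad by (auto simp: smooth_test_def)
  moreover have "0 \<le> E p q x" if "p \<in> T" "q \<in> T" "fst p \<noteq> fst q" for p q x
  proof -
    \<comment> \<open>\<open>G p\<close> involves only coordinates of its own row, so
      \<open>e\<close> vanishes across rows. What remains of \<open>E\<close> are products of two
      first derivatives and further row factors, all nonnegative.\<close>
    have "q \<noteq> p" "q \<noteq> (fst p, v)" for v using that by auto
    then have "e p q x = 0" by (simp add: e_def)
    moreover have G0: "0 \<le> G p' x" for p'
      unfolding G_def using b0 b1 by (intro mult_nonneg_nonneg prod_nonneg) auto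
    moreover have f0: "0 \<le> f u x" for u
      unfolding f_def using b0 by (simp add: prod_le_1)
    ultimately show ?thesis
      unfolding E_def d_def by (auto intro!: G0 f0 mult_nonneg_nonneg sum_nonneg prod_nonneg)
  qed
  ultimately show ?thesis using that by (auto simp: T_def f_def)
qed

section \<open>Gaussian integration by parts\<close>

abbreviation std_normal :: "real measure" where
  "std_normal \<equiv> density lborel std_normal_density"

lemma prob_space_std_normal: "prob_space std_normal"
  by (rule prob_space_normal_density) simp

interpretation std_normal: prob_space std_normal
  by (rule prob_space_std_normal)

interpretation std_normal_product: product_sigma_finite "\<lambda>_. std_normal"
  by standard

lemma integral_std_normal:
  "f \<in> borel_measurable borel \<Longrightarrow> (\<integral>x. f x \<partial>std_normal) = (\<integral>x. std_normal_density x * f x \<partial>lborel)"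
  for f :: "real \<Rightarrow> real"
  by (subst integral_density) auto

lemma integrable_std_normal_iff:
  "f \<in> borel_measurable borel \<Longrightarrow>
    integrable std_normal f \<longleftrightarrow> integrable lborel (\<lambda>x. std_normal_density x * f x)"
  for f :: "real \<Rightarrow> real"
  by (subst integrable_density) auto

lemma integrable_std_normal_power: "integrable std_normal (\<lambda>x. x ^ k)"
  by (subst integrable_std_normal_iff) (auto simp: integrable_std_normal_moment)

lemma integrable_std_normal_id: "integrable std_normal (\<lambda>x. x)"
  using integrable_std_normal_power[of 1] by simp

lemma std_normal_density_deriv:
  "(std_normal_density has_real_derivative - x * std_normal_density x) (at x)"
proof -
  have "((\<lambda>x. exp (- x\<^sup>2 / 2)) has_real_derivative exp (- x\<^sup>2 / 2) * (- x)) (at x)"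
    by (auto intro!: derivative_eq_intros)
  from DERIV_cmult[OF this, of "1 / sqrt (2 * pi)"] show ?thesis
    by (simp add: std_normal_density_def[abs_def] mult_ac)
qed

lemma std_normal_density_at_top: "(std_normal_density \<longlongrightarrow> 0) at_top"
  unfolding std_normal_density_def by real_asymp

lemma std_normal_density_at_bot: "(std_normal_density \<longlongrightarrow> 0) at_bot"
  unfolding std_normal_density_def by real_asymp

lemma integrable_std_normal_bounded:
  fixes f :: "real \<Rightarrow> real"
  assumes "f \<in> borel_measurable borel" "\<And>x. \<bar>f x\<bar> \<le> B * (1 + \<bar>x\<bar> ^ k)"
  shows "integrable std_normal f"
proof (rule Bochner_Integration.integrable_bound)
  show "integrable std_normal (\<lambda>x. B * (1 + \<bar>x\<bar> ^ k))"
    using integrable_abs[OF integrable_std_normal_power[of k]] by (auto simp: power_abs)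
  show "AE x in std_normal. norm (f x) \<le> norm (B * (1 + \<bar>x\<bar> ^ k))"
    using order_trans[OF assms(2) abs_ge_self] by simp
qed (use assms in auto)

text \<open>Stein's identity. The derivative of density times f is the density times f'(x) - x f(x);
  it integrates to zero over the line because a bounded f leaves the decay of the density at both
  ends intact.\<close>

lemma gaussian_integration_by_parts:
  fixes f f' :: "real \<Rightarrow> real"
  assumes f: "\<And>x. (f has_real_derivative f' x) (at x)"
    and f': "continuous_on UNIV f'" and B: "\<And>x. \<bar>f x\<bar> \<le> B" and B': "\<And>x. \<bar>f' x\<bar> \<le> B'"
  shows "(\<integral>x. x * f x \<partial>std_normal) = (\<integral>x. f' x \<partial>std_normal)"
proof -
  have "continuous_on UNIV f" using f DERIV_continuous_on by blast
  then have [measurable]: "f \<in> borel_measurable borel" "f' \<in> borel_measurable borel"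
    using f' by (auto intro: borel_measurable_continuous_onI)
  have [simp]: "B \<ge> 0" "B' \<ge> 0" using B[of 0] B'[of 0] by linarith+
  have i1: "integrable std_normal (\<lambda>x. x * f x)"
  proof (rule integrable_std_normal_bounded[where B = B and k = 1])
    show "\<bar>x * f x\<bar> \<le> B * (1 + \<bar>x\<bar> ^ 1)" for x
      using mult_left_mono[OF B[of x], of "\<bar>x\<bar>"] \<open>B \<ge> 0\<close> by (simp add: abs_mult distrib_left mult.commute add_increasing)
  qed simp
  have i2: "integrable std_normal f'"
  proof (rule integrable_std_normal_bounded[where B = B' and k = 1])
    show "\<bar>f' x\<bar> \<le> B' * (1 + \<bar>x\<bar> ^ 1)" for x
      using B'[of x] mult_left_mono[of 1 "1 + \<bar>x\<bar>" B'] by simp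
  qed simp
  let ?g = "\<lambda>x. std_normal_density x * f' x - std_normal_density x * (x * f x)"
  have i3: "integrable lborel ?g"
    using i1 i2 by (auto simp: integrable_std_normal_iff)
  have "(LBINT x=-\<infinity>..\<infinity>. ?g x) = 0 - 0"
  proof (rule interval_integral_FTC_integrable[where F = "\<lambda>x. std_normal_density x * f x"])
    show "((\<lambda>x. std_normal_density x * f x) has_vector_derivative ?g x) (at x)" for x
      unfolding has_real_derivative_iff_has_vector_derivative[symmetric]
      by (rule derivative_eq_intros f std_normal_density_deriv refl | simp add: algebra_simps)+
    show "isCont ?g x" for x
      using f f' DERIV_isCont[OF std_normal_density_deriv] DERIV_isCont[OF f]
      by (auto intro!: continuous_intros simp: continuous_on_eq_continuous_at)
    show "set_integrable lborel (einterval (-\<infinity>) \<infinity>) ?g"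
      using i3 by (simp add: set_integrable_def)
    have bd: "eventually (\<lambda>x. norm (std_normal_density x * f x) \<le> std_normal_density x * B) F" for F
      by (simp add: abs_mult mult_left_mono[OF B])
    have "((\<lambda>x. std_normal_density x * f x) \<longlongrightarrow> 0) at_bot"
      by (rule Lim_null_comparison[OF bd]) (auto intro!: tendsto_mult_left_zero std_normal_density_at_bot)
    then show "(((\<lambda>x. std_normal_density x * f x) \<circ> real_of_ereal) \<longlongrightarrow> 0) (at_right (-\<infinity>))"
      by (simp add: ereal_tendsto_simps)
    have "((\<lambda>x. std_normal_density x * f x) \<longlongrightarrow> 0) at_top"
      by (rule Lim_null_comparison[OF bd]) (auto intro!: tendsto_mult_left_zero std_normal_density_at_top)
    then show "(((\<lambda>x. std_normal_density x * f x) \<circ> real_of_ereal) \<longlongrightarrow> 0) (at_left \<infinity>)"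
      by (simp add: ereal_tendsto_simps)
  qed simp
  then have "(\<integral>x. ?g x \<partial>lborel) = 0"
    by (simp add: interval_lebesgue_integral_def set_lebesgue_integral_def)
  then show ?thesis
    using i1 i2 by (simp add: integral_std_normal integrable_std_normal_iff)
qed

abbreviation std_normals :: "'i set \<Rightarrow> ('i \<Rightarrow> real) measure" where
  "std_normals I \<equiv> PiM I (\<lambda>_. std_normal)"

lemma measurable_std_normals_component [measurable]:
  "i \<in> I \<Longrightarrow> (\<lambda>x. x i) \<in> borel_measurable (std_normals I)"
  using measurable_component_singleton[of i I "\<lambda>_. std_normal"]
    measurable_cong_sets[of "std_normals I" "std_normals I" std_normal borel] by simp

lemma prob_space_std_normals: "prob_space (std_normals I)"
  by (rule prob_space_PiM) (rule prob_space_std_normal)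

lemma integrable_std_normals_component:
  fixes f :: "real \<Rightarrow> real"
  assumes "i \<in> I" "integrable std_normal f"
  shows "integrable (std_normals I) (\<lambda>x. f (x i))"
    and "(\<integral>x. f (x i) \<partial>std_normals I) = (\<integral>x. f x \<partial>std_normal)"
proof -
  have d: "distr (std_normals I) std_normal (\<lambda>x. x i) = std_normal"
    by (rule distr_PiM_component) (use assms prob_space_std_normal in auto)
  have m: "(\<lambda>x. x i) \<in> measurable (std_normals I) std_normal" using assms(1) by measurable
  have "f \<in> borel_measurable std_normal" using assms(2) by auto
  then show "integrable (std_normals I) (\<lambda>x. f (x i))"
    "(\<integral>x. f (x i) \<partial>std_normals I) = (\<integral>x. f x \<partial>std_normal)"
    using assms(2) integrable_distr_eq[OF m, of f] integral_distr[OF m, of f] by (simp_all add: d)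
qed

text \<open>Fubini integrates the coordinate i first, and the one-dimensional identity applies on
  every slice \<open>x(i := y)\<close>.\<close>

lemma product_gaussian_integration_by_parts:
  fixes G G' :: "('i \<Rightarrow> real) \<Rightarrow> real"
  assumes I: "finite I" "i \<in> I"
    and m: "G \<in> borel_measurable (std_normals I)" "G' \<in> borel_measurable (std_normals I)"
    and d: "\<And>x y. ((\<lambda>y. G (x(i := y))) has_real_derivative G' (x(i := y))) (at y)"
    and c: "\<And>x. continuous_on UNIV (\<lambda>y. G' (x(i := y)))"
    and B: "\<And>x. \<bar>G x\<bar> \<le> B" and B': "\<And>x. \<bar>G' x\<bar> \<le> B'"
  shows "(\<integral>x. x i * G x \<partial>std_normals I) = (\<integral>x. G' x \<partial>std_normals I)"
proof -
  interpret P: prob_space "std_normals I" by (rule prob_space_std_normals)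
  define J where "J = I - {i}"
  have J: "I = insert i J" "finite J" "i \<notin> J" using I by (auto simp: J_def)
  have [simp]: "B \<ge> 0" using B[of undefined] by linarith
  have ibp: "(\<integral>y. y * G (x(i := y)) \<partial>std_normal) = (\<integral>y. G' (x(i := y)) \<partial>std_normal)" for x
    by (rule gaussian_integration_by_parts[where f = "\<lambda>y. G (x(i := y))" and f' = "\<lambda>y. G' (x(i := y))",
        OF d c B B'])
  have int: "integrable (std_normals I) (\<lambda>x. x i * G x)"
  proof (rule Bochner_Integration.integrable_bound)
    show "integrable (std_normals I) (\<lambda>x. x i * B)"
      by (intro integrable_mult_left integrable_std_normals_component I integrable_std_normal_id)
    show "AE x in std_normals I. norm (x i * G x) \<le> norm (x i * B)"
    proof (rule AE_I2)
      fix x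
      have "\<bar>x i\<bar> * \<bar>G x\<bar> \<le> \<bar>x i\<bar> * B" by (intro mult_left_mono B) simp
      then show "norm (x i * G x) \<le> norm (x i * B)" by (simp add: abs_mult)
    qed
    show "(\<lambda>x. x i * G x) \<in> borel_measurable (std_normals I)"
      by (intro borel_measurable_times m(1) measurable_std_normals_component I)
  qed
  have int': "integrable (std_normals I) G'"
    by (rule P.integrable_const_bound[where B = B', OF AE_I2 m(2)]) (simp add: B')
  have "(\<integral>x. x i * G x \<partial>std_normals I) =
      (\<integral>x. (\<integral>y. y * G (x(i := y)) \<partial>std_normal) \<partial>std_normals J)"
    using std_normal_product.product_integral_insert[OF J(2,3), of "\<lambda>x. x i * G x", folded J(1), OF int]
    by (simp only: fun_upd_same)
  also have "\<dots> = (\<integral>x. (\<integral>y. G' (x(i := y)) \<partial>std_normal) \<partial>std_normals J)"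
    by (simp only: ibp)
  also have "\<dots> = (\<integral>x. G' x \<partial>std_normals I)"
    using std_normal_product.product_integral_insert[OF J(2,3), of G', folded J(1), OF int'] by (rule sym)
  finally show ?thesis .
qed

section \<open>The Gaussian comparison inequality\<close>

text \<open>Here the countability of the index type matters: a map into the product space is Borel
  as soon as all its coordinates are.\<close>

lemma bcont_measurable_compose:
  assumes "bcont H" "\<And>p. (\<lambda>x. Z x p) \<in> borel_measurable M"
  shows "(\<lambda>x. H (Z x)) \<in> borel_measurable M"
proof -
  have "Z \<in> borel_measurable M"
    by (rule measurable_coordinatewise_then_product) (rule assms(2))
  from measurable_compose[OF this bcont_borel[OF assms(1)]] show ?thesis .
qed

lemma bcont_continuous_compose:
  assumes "bcont H" "\<And>p. continuous_on S (\<lambda>x. Z x p)"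
  shows "continuous_on S (\<lambda>x. H (Z x))"
  by (rule continuous_on_compose2[OF _ continuous_on_coordinatewise_then_product])
     (use assms in \<open>auto simp: bcont_def\<close>)

text \<open>The two Gaussian processes are joined by the path Z = sin \<theta> A x + cos \<theta> B x. As A and B have
  disjoint supports, integration by parts turns the derivative along this path into the covariance
  difference weighted by second derivatives.\<close>

lemma gaussian_comparison_smooth:
  fixes a b :: "'p::countable \<Rightarrow> 'i \<Rightarrow> real"
  assumes fin: "finite I" "finite T" and st: "smooth_test T F D E"
    and disj: "\<And>p q i. a p i * b q i = 0"
    and sign: "\<And>p q y. p \<in> T \<Longrightarrow> q \<in> T \<Longrightarrow>
      0 \<le> ((\<Sum>i\<in>I. a p i * a q i) - (\<Sum>i\<in>I. b p i * b q i)) * E p q y"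
  shows "(\<integral>x. F (\<lambda>p. \<Sum>i\<in>I. b p i * x i) \<partial>std_normals I) \<le>
    (\<integral>x. F (\<lambda>p. \<Sum>i\<in>I. a p i * x i) \<partial>std_normals I)"
proof -
  interpret P: prob_space "std_normals I" by (rule prob_space_std_normals)
  interpret L: pair_sigma_finite lborel "std_normals I" by standard
  have F: "bcont F" "has_grad T F D" and D: "\<And>p. p \<in> T \<Longrightarrow> bcont (D p)"
    "\<And>p. p \<in> T \<Longrightarrow> has_grad T (D p) (E p)" and E: "\<And>p q. p \<in> T \<Longrightarrow> q \<in> T \<Longrightarrow> bcont (E p q)"
    using st by (auto simp: smooth_test_def)
  \<comment> \<open>At \<theta> = 0 the path is the process of \<open>b\<close>, at \<theta> = pi /
    2 that of \<open>a\<close>. With sine and cosine the velocity \<open>c'\<close> stays bounded up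
    to both ends, unlike with the weights sqrt t and sqrt (1 - t).\<close>
  define c where "c \<theta> p i = sin \<theta> * a p i + cos \<theta> * b p i" for \<theta> p i
  define c' where "c' \<theta> p i = cos \<theta> * a p i - sin \<theta> * b p i" for \<theta> p i
  define Z where "Z \<theta> x p = (\<Sum>i\<in>I. c \<theta> p i * x i)" for \<theta> and x :: "'i \<Rightarrow> real" and p
  define Z' where "Z' \<theta> x p = (\<Sum>i\<in>I. c' \<theta> p i * x i)" for \<theta> and x :: "'i \<Rightarrow> real" and p
  define W where "W \<theta> x = (\<Sum>p\<in>T. D p (Z \<theta> x) * Z' \<theta> x p)" for \<theta> x
  have dc: "((\<lambda>\<theta>. c \<theta> p i) has_real_derivative c' \<theta> p i) (at \<theta>)" for p i \<theta>
    unfolding c_def c'_def by (auto intro!: derivative_eq_intros)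
  have dZ: "((\<lambda>\<theta>. Z \<theta> x p) has_real_derivative Z' \<theta> x p) (at \<theta>)" for p x \<theta>
    unfolding Z_def Z'_def by (intro DERIV_sum DERIV_cmult_right dc)
  have cZ: "continuous_on UNIV (\<lambda>\<theta>. Z \<theta> x p)" for x p
    unfolding Z_def c_def by (intro continuous_intros)
  have cW: "continuous_on UNIV (\<lambda>\<theta>. W \<theta> x)" for x
    unfolding W_def Z'_def c'_def
    by (intro continuous_intros bcont_continuous_compose[OF D(1)] cZ)
  have path: "F (Z (pi / 2) x) - F (Z 0 x) = (\<integral>\<theta>. indicator {0..pi / 2} \<theta> *\<^sub>R W \<theta> x \<partial>lborel)" for x
  proof (rule integral_FTC_atLeastAtMost[symmetric])
    fix \<theta>
    have "((\<lambda>\<theta>. F (Z \<theta> x)) has_real_derivative W \<theta> x) (at \<theta>)"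
      using has_gradD[OF F(2), of "\<lambda>p \<theta>. Z \<theta> x p" "Z' \<theta> x" \<theta>] dZ by (simp add: W_def)
    then show "((\<lambda>\<theta>. F (Z \<theta> x)) has_vector_derivative W \<theta> x) (at \<theta> within {0..pi / 2})"
      by (simp add: has_real_derivative_iff_has_vector_derivative has_vector_derivative_at_within)
  next
    show "continuous_on {0..pi / 2} (\<lambda>\<theta>. W \<theta> x)"
      by (rule continuous_on_subset[OF cW]) simp
  qed simp
  have mx: "(\<lambda>x. x i) \<in> borel_measurable (std_normals I)" if "i \<in> I" for i
    using that by measurable
  have mx2: "(\<lambda>\<omega>. snd \<omega> i) \<in> borel_measurable (lborel \<Otimes>\<^sub>M std_normals I)" if "i \<in> I" for i
    by (rule measurable_compose[OF measurable_snd mx[OF that]])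
  have mZ: "(\<lambda>\<omega>. Z (fst \<omega>) (snd \<omega>) p) \<in> borel_measurable (lborel \<Otimes>\<^sub>M std_normals I)" for p
    unfolding Z_def c_def by (intro borel_measurable_sum borel_measurable_times mx2) measurable
  have mW: "(\<lambda>\<omega>. W (fst \<omega>) (snd \<omega>)) \<in> borel_measurable (lborel \<Otimes>\<^sub>M std_normals I)"
    unfolding W_def Z'_def c'_def
    by (intro borel_measurable_sum borel_measurable_times mx2 bcont_measurable_compose[OF D(1)] mZ) measurable
  have mZ1: "(\<lambda>x. Z \<theta> x p) \<in> borel_measurable (std_normals I)" for \<theta> p
    unfolding Z_def by (intro borel_measurable_sum borel_measurable_times mx borel_measurable_const)
  have "\<forall>p\<in>T. \<exists>B. \<forall>x. \<bar>D p x\<bar> \<le> B" using D(1) by (auto simp: bcont_def)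
  then obtain C where C: "\<And>p x. p \<in> T \<Longrightarrow> \<bar>D p x\<bar> \<le> C p" by metis
  have C0: "0 \<le> C p" if "p \<in> T" for p using C[OF that, of undefined] by linarith
  \<comment> \<open>An integrable majorant of \<open>W\<close> that is free of \<theta>; it serves
    both Fubini on the strip and integrability at a fixed \<theta>.\<close>
  define K where "K x = (\<Sum>p\<in>T. C p * (\<Sum>i\<in>I. (\<bar>a p i\<bar> + \<bar>b p i\<bar>) * \<bar>x i\<bar>))" for x :: "'i \<Rightarrow> real"
  have K0: "0 \<le> K x" for x unfolding K_def using C0 by (intro sum_nonneg mult_nonneg_nonneg) auto
  have WK: "\<bar>W \<theta> x\<bar> \<le> K x" for \<theta> x
  proof -
    have "\<bar>c' \<theta> p i\<bar> \<le> \<bar>a p i\<bar> + \<bar>b p i\<bar>" for p i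
    proof -
      have "\<bar>c' \<theta> p i\<bar> \<le> \<bar>cos \<theta>\<bar> * \<bar>a p i\<bar> + \<bar>sin \<theta>\<bar> * \<bar>b p i\<bar>"
        unfolding c'_def by (metis abs_mult abs_triangle_ineq4)
      also have "\<dots> \<le> 1 * \<bar>a p i\<bar> + 1 * \<bar>b p i\<bar>"
        by (intro add_mono mult_right_mono) auto
      finally show ?thesis by simp
    qed
    then have "\<bar>Z' \<theta> x p\<bar> \<le> (\<Sum>i\<in>I. (\<bar>a p i\<bar> + \<bar>b p i\<bar>) * \<bar>x i\<bar>)" for p
      unfolding Z'_def by (intro order_trans[OF sum_abs] sum_mono) (auto simp: abs_mult intro: mult_right_mono)
    then show ?thesis
      unfolding W_def K_def
      by (intro order_trans[OF sum_abs] sum_mono) (auto simp: abs_mult intro!: mult_mono C C0)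
  qed
  have ix: "integrable (std_normals I) (\<lambda>x. \<bar>x i\<bar>)" if "i \<in> I" for i
    by (intro integrable_abs integrable_std_normals_component[OF that integrable_std_normal_id])
  have iK: "integrable (std_normals I) K"
    unfolding K_def by (intro integrable_mult_right Bochner_Integration.integrable_sum ix)
  have iW1: "integrable (std_normals I) (W \<theta>)" for \<theta>
  proof (rule Bochner_Integration.integrable_bound[OF iK])
    show "W \<theta> \<in> borel_measurable (std_normals I)"
      unfolding W_def[abs_def] Z'_def
      by (intro borel_measurable_sum borel_measurable_times mx bcont_measurable_compose[OF D(1)] mZ1 borel_measurable_const)
    show "AE x in std_normals I. norm (W \<theta> x) \<le> norm (K x)"
      using WK order_trans[OF WK abs_ge_self] by simp
  qed
  have int: "integrable (lborel \<Otimes>\<^sub>M std_normals I) (\<lambda>(\<theta>, x). indicator {0..pi / 2} \<theta> *\<^sub>R W \<theta> x)"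
  proof (rule Bochner_Integration.integrable_bound)
    show "integrable (lborel \<Otimes>\<^sub>M std_normals I) (\<lambda>\<omega>. indicator {0..pi / 2} (fst \<omega>) * K (snd \<omega>))"
    proof (rule L.Fubini_integrable)
      show "(\<lambda>\<omega>. indicator {0..pi / 2} (fst \<omega>) * K (snd \<omega>)) \<in> borel_measurable (lborel \<Otimes>\<^sub>M std_normals I)"
        using borel_measurable_integrable[OF iK] by measurable
    qed (use iK in \<open>auto simp: abs_mult\<close>)
    show "(\<lambda>(\<theta>, x). indicator {0..pi / 2} \<theta> *\<^sub>R W \<theta> x) \<in> borel_measurable (lborel \<Otimes>\<^sub>M std_normals I)"
      unfolding case_prod_beta' by (intro borel_measurable_scaleR mW) measurable
    show "AE \<omega> in lborel \<Otimes>\<^sub>M std_normals I. norm (case \<omega> of (\<theta>, x) \<Rightarrow> indicator {0..pi / 2} \<theta> *\<^sub>R W \<theta> x)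
        \<le> norm (indicator {0..pi / 2} (fst \<omega>) * K (snd \<omega>))"
    proof (rule AE_I2)
      fix \<omega> :: "real \<times> ('i \<Rightarrow> real)"
      have "indicator {0..pi / 2} (fst \<omega>) * \<bar>W (fst \<omega>) (snd \<omega>)\<bar> \<le> indicator {0..pi / 2} (fst \<omega>) * K (snd \<omega>)"
        by (rule mult_left_mono[OF WK]) simp
      then show "norm (case \<omega> of (\<theta>, x) \<Rightarrow> indicator {0..pi / 2} \<theta> *\<^sub>R W \<theta> x)
        \<le> norm (indicator {0..pi / 2} (fst \<omega>) * K (snd \<omega>))"
        using K0[of "snd \<omega>"] by (simp add: case_prod_unfold abs_mult)
    qed
  qed
  have EW: "0 \<le> (\<integral>x. W \<theta> x \<partial>std_normals I)" if \<theta>: "\<theta> \<in> {0..pi / 2}" for \<theta>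
  proof -
    \<comment> \<open>As a function of the single coordinate \<open>x i\<close>, each
      \<open>Z \<theta> x q\<close> is affine with slope \<open>c \<theta> q i\<close>; the chain
      rule thus brings in the second derivatives \<open>E p q\<close> with these slopes as
      weights.\<close>
    have ibp: "(\<integral>x. x i * D p (Z \<theta> x) \<partial>std_normals I) =
        (\<Sum>q\<in>T. c \<theta> q i * (\<integral>x. E p q (Z \<theta> x) \<partial>std_normals I))" if p: "p \<in> T" and i: "i \<in> I" for p i
    proof -
      define G' where "G' z = (\<Sum>q\<in>T. E p q z * c \<theta> q i)" for z
      have G': "bcont G'" unfolding G'_def using E p by (intro bcont_intros) auto
      obtain B where B: "\<And>x. \<bar>D p x\<bar> \<le> B" using bcontE[OF D(1)[OF p]] by blast
      obtain B' where B': "\<And>x. \<bar>G' x\<bar> \<le> B'" using bcontE[OF G'] by blast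
      have "((\<lambda>y. Z \<theta> (x(i := y)) q) has_real_derivative c \<theta> q i) (at y)" for x q y
      proof -
        have "Z \<theta> (x(i := y)) q = (\<Sum>j\<in>I - {i}. c \<theta> q j * x j) + c \<theta> q i * y" for y
          unfolding Z_def using fin i by (subst sum.remove[of I i]) (auto intro!: sum.cong)
        then show ?thesis by (auto intro!: derivative_eq_intros)
      qed
      note dZi = this
      have "(\<integral>x. x i * D p (Z \<theta> x) \<partial>std_normals I) = (\<integral>x. G' (Z \<theta> x) \<partial>std_normals I)"
      proof (rule product_gaussian_integration_by_parts[OF fin(1) i, where B = B and B' = B'])
        show "((\<lambda>y. D p (Z \<theta> (x(i := y)))) has_real_derivative G' (Z \<theta> (x(i := y)))) (at y)" for x y
          using has_gradD[OF D(2)[OF p], of "\<lambda>q y. Z \<theta> (x(i := y)) q" "\<lambda>q. c \<theta> q i" y] dZi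
          by (simp add: G'_def)
        show "continuous_on UNIV (\<lambda>y. G' (Z \<theta> (x(i := y))))" for x
          by (rule bcont_continuous_compose[OF G'], rule DERIV_continuous_on)
             (rule has_field_derivative_at_within, rule dZi)
        show "(\<lambda>x. D p (Z \<theta> x)) \<in> borel_measurable (std_normals I)"
          by (rule bcont_measurable_compose[OF D(1)[OF p] mZ1])
        show "(\<lambda>x. G' (Z \<theta> x)) \<in> borel_measurable (std_normals I)"
          by (rule bcont_measurable_compose[OF G' mZ1])
      qed (use B B' in auto)
      also have "\<dots> = (\<Sum>q\<in>T. (\<integral>x. E p q (Z \<theta> x) * c \<theta> q i \<partial>std_normals I))"
        unfolding G'_def
      proof (rule Bochner_Integration.integral_sum)
        fix q assume "q \<in> T"
        then have bE: "bcont (E p q)" using E p by auto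
        obtain B where "\<And>x. \<bar>E p q x\<bar> \<le> B" using bcontE[OF bE] by blast
        then have "integrable (std_normals I) (\<lambda>x. E p q (Z \<theta> x))"
          by (intro P.integrable_const_bound[where B = B] bcont_measurable_compose[OF bE mZ1]) auto
        then show "integrable (std_normals I) (\<lambda>x. E p q (Z \<theta> x) * c \<theta> q i)" by simp
      qed
      finally show ?thesis by (simp add: mult.commute)
    qed
    have iD: "integrable (std_normals I) (\<lambda>x. x i * D p (Z \<theta> x))" if p: "p \<in> T" and i: "i \<in> I" for p i
    proof (rule Bochner_Integration.integrable_bound)
      show "integrable (std_normals I) (\<lambda>x. \<bar>x i\<bar> * C p)" using ix[OF i] by simp
      show "(\<lambda>x. x i * D p (Z \<theta> x)) \<in> borel_measurable (std_normals I)"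
        by (intro borel_measurable_times mx i bcont_measurable_compose[OF D(1)[OF p] mZ1])
      show "AE x in std_normals I. norm (x i * D p (Z \<theta> x)) \<le> norm (\<bar>x i\<bar> * C p)"
      proof (rule AE_I2)
        fix x
        have "\<bar>x i\<bar> * \<bar>D p (Z \<theta> x)\<bar> \<le> \<bar>x i\<bar> * C p" by (rule mult_left_mono[OF C[OF p]]) simp
        then show "norm (x i * D p (Z \<theta> x)) \<le> norm (\<bar>x i\<bar> * C p)"
          using C0[OF p] by (simp add: abs_mult)
      qed
    qed
    have W_eq: "W \<theta> = (\<lambda>x. \<Sum>p\<in>T. \<Sum>i\<in>I. c' \<theta> p i * (x i * D p (Z \<theta> x)))"
      by (simp add: W_def Z'_def sum_distrib_left mult_ac fun_eq_iff)
    have "(\<integral>x. W \<theta> x \<partial>std_normals I) =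
        (\<Sum>p\<in>T. \<Sum>i\<in>I. c' \<theta> p i * (\<integral>x. x i * D p (Z \<theta> x) \<partial>std_normals I))"
      unfolding W_eq using iD by simp
    also have "\<dots> = (\<Sum>p\<in>T. \<Sum>q\<in>T. (\<Sum>i\<in>I. c' \<theta> p i * c \<theta> q i) * (\<integral>x. E p q (Z \<theta> x) \<partial>std_normals I))"
      using ibp by (simp add: sum_distrib_left sum_distrib_right mult_ac sum.swap[of _ I])
    also have "\<dots> = (\<Sum>p\<in>T. \<Sum>q\<in>T. (\<integral>x. sin \<theta> * cos \<theta> *
        (((\<Sum>i\<in>I. a p i * a q i) - (\<Sum>i\<in>I. b p i * b q i)) * E p q (Z \<theta> x)) \<partial>std_normals I))"
    proof (intro sum.cong refl)
      fix p q
      \<comment> \<open>The mixed products of \<open>a\<close> and \<open>b\<close> vanish for each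
        i by disjointness of the supports. The common factor sin \<theta> cos \<theta> is
        nonnegative on the quarter circle, so the covariance difference alone decides the
        sign.\<close>
      have "c' \<theta> p i * c \<theta> q i = sin \<theta> * cos \<theta> * (a p i * a q i - b p i * b q i)" for i
      proof -
        have "c' \<theta> p i * c \<theta> q i = sin \<theta> * cos \<theta> * (a p i * a q i - b p i * b q i)
            + (cos \<theta>)\<^sup>2 * (a p i * b q i) - (sin \<theta>)\<^sup>2 * (a q i * b p i)"
          unfolding c_def c'_def by (simp add: algebra_simps power2_eq_square)
        then show ?thesis using disj[of p i q] disj[of q i p] by simp
      qed
      then have "(\<Sum>i\<in>I. c' \<theta> p i * c \<theta> q i) =
          sin \<theta> * cos \<theta> * ((\<Sum>i\<in>I. a p i * a q i) - (\<Sum>i\<in>I. b p i * b q i))"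
        by (simp add: sum_distrib_left[symmetric] sum_subtractf)
      then show "(\<Sum>i\<in>I. c' \<theta> p i * c \<theta> q i) * (\<integral>x. E p q (Z \<theta> x) \<partial>std_normals I) =
        (\<integral>x. sin \<theta> * cos \<theta> * (((\<Sum>i\<in>I. a p i * a q i) - (\<Sum>i\<in>I. b p i * b q i)) * E p q (Z \<theta> x)) \<partial>std_normals I)"
        by (simp add: mult.assoc)
    qed
    also have "\<dots> \<ge> 0"
      using \<theta> sin_ge_zero[of \<theta>] cos_ge_zero[of \<theta>]
      by (intro sum_nonneg integral_nonneg_AE AE_I2 mult_nonneg_nonneg[OF _ sign]) auto
    finally show ?thesis .
  qed
  have iF: "integrable (std_normals I) (\<lambda>x. F (Z \<theta> x))" for \<theta>
  proof -
    obtain B where "\<And>x. \<bar>F x\<bar> \<le> B" using bcontE[OF F(1)] by blast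
    then show ?thesis
      by (intro P.integrable_const_bound[where B = B] bcont_measurable_compose[OF F(1) mZ1]) auto
  qed
  have "(\<integral>x. F (Z (pi / 2) x) \<partial>std_normals I) - (\<integral>x. F (Z 0 x) \<partial>std_normals I) =
      (\<integral>x. (\<integral>\<theta>. indicator {0..pi / 2} \<theta> *\<^sub>R W \<theta> x \<partial>lborel) \<partial>std_normals I)"
    unfolding path[symmetric] by (rule Bochner_Integration.integral_diff[OF iF iF, symmetric])
  also have "\<dots> = (\<integral>\<theta>. (\<integral>x. indicator {0..pi / 2} \<theta> *\<^sub>R W \<theta> x \<partial>std_normals I) \<partial>lborel)"
    by (rule L.Fubini_integral[OF int])
  also have "\<dots> \<ge> 0"
  proof (rule integral_nonneg_AE, rule AE_I2)
    fix \<theta> :: real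
    show "0 \<le> (\<integral>x. indicator {0..pi / 2} \<theta> *\<^sub>R W \<theta> x \<partial>std_normals I)"
      using EW[of \<theta>] by (cases "\<theta> \<in> {0..pi / 2}") auto
  qed
  finally show ?thesis by (simp add: Z_def[abs_def] c_def)
qed

section \<open>Logistic steps as smooth approximations of indicators\<close>

definition logistic :: "real \<Rightarrow> real" where
  "logistic s = 1 / (1 + exp s)"

lemma logistic_bounds: "0 \<le> logistic s" "logistic s \<le> 1"
  unfolding logistic_def by (auto simp: divide_simps add_pos_pos)

text \<open>The derivative is a polynomial in the function itself, so all derivative bounds reduce
  to values lying in the unit interval.\<close>

lemma logistic_deriv:
  "((\<lambda>t. logistic (\<beta> * (t - c))) has_real_derivative
     - \<beta> * (logistic (\<beta> * (t - c)) * (1 - logistic (\<beta> * (t - c))))) (at t)"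
proof -
  have [simp]: "1 + exp s \<noteq> 0" for s :: real by (smt (verit) exp_gt_zero)
  have "1 - 1 / (1 + exp s) = exp s / (1 + exp s)" for s :: real by (simp add: field_simps)
  then show ?thesis
    unfolding logistic_def by (auto intro!: derivative_eq_intros simp: divide_simps)
qed

text \<open>The value 1/2 at the jump does no harm: the limit is only squeezed between the
  indicators of the strict and of the weak inequality.\<close>

lemma logistic_limit:
  "(\<lambda>k. logistic (real k * s)) \<longlonglongrightarrow> (if s > 0 then 0 else if s = 0 then 1 / 2 else 1)"
proof -
  consider "s > 0" | "s = 0" | "s < 0" by linarith
  then show ?thesis
  proof cases
    case 1
    then have "(\<lambda>k. logistic (real k * s)) \<longlonglongrightarrow> 0" unfolding logistic_def by real_asymp
    then show ?thesis using 1 by simp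
  next
    case 2
    then show ?thesis by (simp add: logistic_def)
  next
    case 3
    then have "(\<lambda>k. logistic (real k * s)) \<longlonglongrightarrow> 1" unfolding logistic_def by real_asymp
    then show ?thesis using 3 by simp
  qed
qed

lemma smooth_test_logistic:
  fixes U :: "'u::countable set" and V :: "'v::countable set" and c :: "'u \<times> 'v \<Rightarrow> real"
  assumes fin: "finite U" "finite V" and \<beta>: "0 \<le> \<beta>"
  obtains D E where
    "smooth_test (U \<times> V) (\<lambda>x. \<Prod>u\<in>U. 1 - (\<Prod>v\<in>V. logistic (\<beta> * (x (u, v) - c (u, v))))) D E"
    "\<And>p q x. p \<in> U \<times> V \<Longrightarrow> q \<in> U \<times> V \<Longrightarrow> fst p \<noteq> fst q \<Longrightarrow> 0 \<le> E p q x"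
proof -
  define \<psi> where "\<psi> p t = logistic (\<beta> * (t - c p))" for p t
  define \<psi>' where "\<psi>' p t = - \<beta> * (\<psi> p t * (1 - \<psi> p t))" for p t
  define \<psi>'' where "\<psi>'' p t = \<beta>\<^sup>2 * (\<psi> p t * (1 - \<psi> p t) * (1 - 2 * \<psi> p t))" for p t
  have b0: "0 \<le> \<psi> p t" "\<psi> p t \<le> 1" for p t unfolding \<psi>_def by (rule logistic_bounds)+
  have d1: "(\<psi> p has_real_derivative \<psi>' p t) (at t)" for p t
    unfolding \<psi>'_def \<psi>_def by (rule logistic_deriv)
  have d2: "(\<psi>' p has_real_derivative \<psi>'' p t) (at t)" for p t
  proof -
    have "((\<lambda>t. - \<beta> * (\<psi> p t * (1 - \<psi> p t))) has_real_derivative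
        - \<beta> * (\<psi> p t * (0 - \<psi>' p t) + \<psi>' p t * (1 - \<psi> p t))) (at t)"
      by (intro DERIV_cmult DERIV_mult' DERIV_diff DERIV_const d1)
    moreover have "- \<beta> * (\<psi> p t * (0 - \<psi>' p t) + \<psi>' p t * (1 - \<psi> p t)) = \<psi>'' p t"
      unfolding \<psi>''_def \<psi>'_def by (simp add: algebra_simps power2_eq_square)
    ultimately show ?thesis unfolding \<psi>'_def by simp
  qed
  have "continuous_on UNIV (\<psi> p)" for p
    by (rule DERIV_continuous_on[OF has_field_derivative_at_within[OF d1]])
  then have c2: "continuous_on UNIV (\<psi>'' p)" for p
    unfolding \<psi>''_def by (intro continuous_intros)
  have q1: "\<bar>\<psi> p t * (1 - \<psi> p t)\<bar> \<le> 1" for p t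
    using mult_mono[of "\<psi> p t" 1 "1 - \<psi> p t" 1] b0[of p t] by (simp add: abs_mult)
  have q2: "\<bar>\<psi> p t * (1 - \<psi> p t) * (1 - 2 * \<psi> p t)\<bar> \<le> 1" for p t
  proof -
    have "\<bar>\<psi> p t * (1 - \<psi> p t)\<bar> * \<bar>1 - 2 * \<psi> p t\<bar> \<le> 1 * 1"
      by (rule mult_mono[OF q1]) (use b0[of p t] in auto)
    then show ?thesis by (simp only: abs_mult)
  qed
  have b1: "\<psi>' p t \<le> 0" for p t
    unfolding \<psi>'_def using b0[of p t] \<beta> by simp
  \<comment> \<open>A single constant has to bound both derivatives; the first is at most \<beta> in
    absolute value, the second at most the square of \<beta>.\<close>
  have b1': "\<bar>\<psi>' p t\<bar> \<le> \<beta> + \<beta>\<^sup>2" for p t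
  proof -
    have "\<beta> * \<bar>\<psi> p t * (1 - \<psi> p t)\<bar> \<le> \<beta> * 1" by (rule mult_left_mono[OF q1 \<beta>])
    moreover have "\<bar>\<psi>' p t\<bar> = \<beta> * \<bar>\<psi> p t * (1 - \<psi> p t)\<bar>" unfolding \<psi>'_def using \<beta> by (simp add: abs_mult)
    ultimately show ?thesis using zero_le_power2[of \<beta>] by linarith
  qed
  have b2: "\<bar>\<psi>'' p t\<bar> \<le> \<beta> + \<beta>\<^sup>2" for p t
  proof -
    have "\<beta>\<^sup>2 * \<bar>\<psi> p t * (1 - \<psi> p t) * (1 - 2 * \<psi> p t)\<bar> \<le> \<beta>\<^sup>2 * 1"
      by (rule mult_left_mono[OF q2]) simp
    moreover have "\<bar>\<psi>'' p t\<bar> = \<beta>\<^sup>2 * \<bar>\<psi> p t * (1 - \<psi> p t) * (1 - 2 * \<psi> p t)\<bar>"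
      unfolding \<psi>''_def by (simp add: abs_mult)
    ultimately show ?thesis using \<beta> by linarith
  qed
  show ?thesis
    by (rule smooth_test_min_max[where \<psi> = \<psi> and \<psi>' = \<psi>' and \<psi>'' = \<psi>'', OF fin d1 d2 c2 b0 b1 b1' b2])
       (rule that[unfolded \<psi>_def[symmetric]])
qed

text \<open>As the steps sharpen, the test functions converge to a limit that is 1 where the strict
  min-max condition holds and 0 where the weak one fails. Hence the strict inequality for
  \<open>b\<close> and the weak one for \<open>a\<close>. Pairs in the same row contribute nothing,
  since their covariances agree; the other pairs have second derivatives of the right sign.\<close>

lemma finite_gaussian_min_max_comparison:
  fixes U :: "'u::countable set" and V :: "'v::countable set"
    and a b :: "'u \<times> 'v \<Rightarrow> 'i \<Rightarrow> real" and c :: "'u \<times> 'v \<Rightarrow> real"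
  assumes fin: "finite I" "finite U" "finite V"
    and disj: "\<And>p q i. a p i * b q i = 0"
    and cov_le: "\<And>p q. (\<Sum>i\<in>I. b p i * b q i) \<le> (\<Sum>i\<in>I. a p i * a q i)"
    and cov_eq: "\<And>p q. fst p = fst q \<Longrightarrow> (\<Sum>i\<in>I. b p i * b q i) = (\<Sum>i\<in>I. a p i * a q i)"
  shows "measure (std_normals I) {x \<in> space (std_normals I). \<forall>u\<in>U. \<exists>v\<in>V. c (u, v) < (\<Sum>i\<in>I. b (u, v) i * x i)}
    \<le> measure (std_normals I) {x \<in> space (std_normals I). \<forall>u\<in>U. \<exists>v\<in>V. c (u, v) \<le> (\<Sum>i\<in>I. a (u, v) i * x i)}"
    (is "measure ?P ?Y \<le> measure ?P ?X")
proof -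
  interpret P: prob_space "std_normals I" by (rule prob_space_std_normals)
  define \<psi> where "\<psi> k p t = logistic (real k * (t - c p))" for k p t
  define F where "F k x = (\<Prod>u\<in>U. 1 - (\<Prod>v\<in>V. \<psi> k (u, v) (x (u, v))))" for k x
  define l where "l s = (if s > 0 then 0 else if s = 0 then 1 / 2 else 1 :: real)" for s :: real
  define L where "L x = (\<Prod>u\<in>U. 1 - (\<Prod>v\<in>V. l (x (u, v) - c (u, v))))" for x
  define A where "A x p = (\<Sum>i\<in>I. a p i * x i)" for x :: "'i \<Rightarrow> real" and p
  define B where "B x p = (\<Sum>i\<in>I. b p i * x i)" for x :: "'i \<Rightarrow> real" and p
  have mA: "(\<lambda>x. A x p) \<in> borel_measurable ?P" and mB: "(\<lambda>x. B x p) \<in> borel_measurable ?P" for p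
    unfolding A_def B_def by (intro borel_measurable_sum borel_measurable_times
        borel_measurable_const measurable_std_normals_component; assumption)+
  have ml: "l \<in> borel_measurable borel" unfolding l_def by measurable
  have mF: "(\<lambda>x. F k (Z x)) \<in> borel_measurable ?P" and mL: "(\<lambda>x. L (Z x)) \<in> borel_measurable ?P"
    if "\<And>p. (\<lambda>x. Z x p) \<in> borel_measurable ?P" for Z k
  proof -
    have "(\<lambda>x. logistic (real k * (Z x p - c p))) \<in> borel_measurable ?P" for p
      unfolding logistic_def using that by measurable
    then show "(\<lambda>x. F k (Z x)) \<in> borel_measurable ?P"
      unfolding F_def \<psi>_def by (intro borel_measurable_prod borel_measurable_diff borel_measurable_const)
    have "(\<lambda>x. l (Z x p - c p)) \<in> borel_measurable ?P" for p
      by (intro measurable_compose[OF _ ml] borel_measurable_diff that borel_measurable_const)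
    then show "(\<lambda>x. L (Z x)) \<in> borel_measurable ?P"
      unfolding L_def by (intro borel_measurable_prod borel_measurable_diff borel_measurable_const)
  qed
  have prod01: "0 \<le> (\<Prod>u\<in>U. 1 - (\<Prod>v\<in>V. h u v)) \<and> (\<Prod>u\<in>U. 1 - (\<Prod>v\<in>V. h u v)) \<le> 1"
    if h: "\<And>u v. 0 \<le> h u v \<and> h u v \<le> 1" for h :: "'u \<Rightarrow> 'v \<Rightarrow> real"
  proof -
    have "0 \<le> (\<Prod>v\<in>V. h u v) \<and> (\<Prod>v\<in>V. h u v) \<le> 1" for u
      by (intro conjI prod_nonneg prod_le_1 h) (simp add: h)
    then have "0 \<le> 1 - (\<Prod>v\<in>V. h u v) \<and> 1 - (\<Prod>v\<in>V. h u v) \<le> 1" for u by simp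
    then show ?thesis by (intro conjI prod_nonneg prod_le_1) simp_all
  qed
  have F01: "0 \<le> F k x \<and> F k x \<le> 1" for k x
    unfolding F_def \<psi>_def by (rule prod01) (simp add: logistic_bounds)
  have l01: "0 \<le> l s \<and> l s \<le> 1" for s by (simp add: l_def)
  have L01: "0 \<le> L x \<and> L x \<le> 1" for x
    unfolding L_def by (rule prod01) (rule l01)
  have lim: "(\<lambda>k. F k x) \<longlonglongrightarrow> L x" for x
    unfolding F_def L_def \<psi>_def l_def by (intro tendsto_intros logistic_limit)
  have le: "(\<integral>x. F k (B x) \<partial>?P) \<le> (\<integral>x. F k (A x) \<partial>?P)" for k
  proof -
    have F_eq: "F k = (\<lambda>x. \<Prod>u\<in>U. 1 - (\<Prod>v\<in>V. logistic (real k * (x (u, v) - c (u, v)))))"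
      by (rule ext) (simp only: F_def \<psi>_def)
    obtain D E where DE': "smooth_test (U \<times> V)
        (\<lambda>x. \<Prod>u\<in>U. 1 - (\<Prod>v\<in>V. logistic (real k * (x (u, v) - c (u, v))))) D E"
      and sgn: "\<And>p q x. p \<in> U \<times> V \<Longrightarrow> q \<in> U \<times> V \<Longrightarrow> fst p \<noteq> fst q \<Longrightarrow> 0 \<le> E p q x"
      by (rule smooth_test_logistic[OF fin(2,3) of_nat_0_le_iff[of k], where c = c]) (rule that)
    have DE: "smooth_test (U \<times> V) (F k) D E" unfolding F_eq by (rule DE')
    show ?thesis unfolding A_def[abs_def] B_def[abs_def]
    proof (rule gaussian_comparison_smooth[OF fin(1) _ DE disj])
      fix p q y assume pq: "p \<in> U \<times> V" "q \<in> U \<times> V"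
      show "0 \<le> ((\<Sum>i\<in>I. a p i * a q i) - (\<Sum>i\<in>I. b p i * b q i)) * E p q y"
      proof (cases "fst p = fst q")
        case True
        then show ?thesis by (simp add: cov_eq)
      next
        case False
        show ?thesis by (rule mult_nonneg_nonneg[OF _ sgn[OF pq False]]) (simp add: cov_le)
      qed
    qed (use fin in auto)
  qed
  have conv: "(\<lambda>k. \<integral>x. F k (Z x) \<partial>?P) \<longlonglongrightarrow> (\<integral>x. L (Z x) \<partial>?P)"
    if Z: "\<And>p. (\<lambda>x. Z x p) \<in> borel_measurable ?P" for Z
  proof (rule integral_dominated_convergence)
    show "(\<lambda>x. L (Z x)) \<in> borel_measurable ?P" by (rule mL[OF Z])
    show "(\<lambda>x. F k (Z x)) \<in> borel_measurable ?P" for k by (rule mF[OF Z])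
    show "integrable ?P (\<lambda>_. 1 :: real)" by simp
    show "AE x in ?P. (\<lambda>k. F k (Z x)) \<longlonglongrightarrow> L (Z x)" by (rule AE_I2) (rule lim)
    show "AE x in ?P. norm (F k (Z x)) \<le> 1" for k by (rule AE_I2) (simp add: F01)
  qed
  have mY: "?Y \<in> sets ?P" and mX: "?X \<in> sets ?P"
    unfolding A_def[symmetric] B_def[symmetric]
    by (intro sets.sets_Collect_finite_All sets.sets_Collect_finite_Ex fin
        borel_measurable_less borel_measurable_le mA mB borel_measurable_const)+
  have iL: "integrable ?P (\<lambda>x. L (Z x))" if Z: "\<And>p. (\<lambda>x. Z x p) \<in> borel_measurable ?P" for Z
    by (rule P.integrable_const_bound[where B = 1, OF AE_I2 mL[OF Z]]) (simp add: L01)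
  have ind: "integrable ?P (indicator S :: _ \<Rightarrow> real)" if "S \<in> sets ?P" for S
    by (rule P.integrable_const_bound[where B = 1]) (use that in \<open>auto simp: indicator_def\<close>)
  have int_ind: "(\<integral>x. indicator S x \<partial>?P) = measure ?P S" if "S \<in> sets ?P" for S
    using that by simp
  have YL: "indicator ?Y x \<le> L (B x)" for x
  proof (cases "x \<in> ?Y")
    case True
    have "(\<Prod>v\<in>V. l (B x (u, v) - c (u, v))) = 0" if u: "u \<in> U" for u
    proof -
      obtain v where v: "v \<in> V" "c (u, v) < B x (u, v)" using True u unfolding B_def by blast
      then have "l (B x (u, v) - c (u, v)) = 0" by (simp add: l_def)
      then show ?thesis using v(1) fin(3) by (rule_tac prod_zero) auto
    qed
    then have "L (B x) = 1" unfolding L_def by simp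
    then show ?thesis by (simp add: indicator_def)
  next
    case False
    show ?thesis unfolding indicator_simps(2)[OF False] by (rule conjunct1[OF L01])
  qed
  have LX: "L (A x) \<le> indicator ?X x" if x: "x \<in> space ?P" for x
  proof (cases "x \<in> ?X")
    case True
    show ?thesis unfolding indicator_simps(1)[OF True] by (rule conjunct2[OF L01])
  next
    case False
    then have "\<exists>u\<in>U. \<forall>v\<in>V. A x (u, v) < c (u, v)"
      using x unfolding A_def not_le[symmetric] by blast
    then obtain u where u: "u \<in> U" "\<And>v. v \<in> V \<Longrightarrow> A x (u, v) < c (u, v)" by blast
    have "l (A x (u, v) - c (u, v)) = 1" if "v \<in> V" for v using u(2)[OF that] by (simp add: l_def)
    then have "(\<Prod>v\<in>V. l (A x (u, v) - c (u, v))) = 1" by (intro prod.neutral) blast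
    then have "L (A x) = 0" unfolding L_def using u(1) fin(2) by (intro prod_zero bexI[of _ u]) simp_all
    then show ?thesis by simp
  qed
  have "measure ?P ?Y = (\<integral>x. indicator ?Y x \<partial>?P)" by (rule int_ind[OF mY, symmetric])
  also have "\<dots> \<le> (\<integral>x. L (B x) \<partial>?P)"
    by (rule integral_mono[OF ind[OF mY] iL[OF mB] YL])
  also have "\<dots> \<le> (\<integral>x. L (A x) \<partial>?P)"
    by (rule LIMSEQ_le[OF conv[OF mB] conv[OF mA]]) (intro exI[of _ 0] allI impI le)
  also have "\<dots> \<le> (\<integral>x. indicator ?X x \<partial>?P)"
    by (rule integral_mono[OF iL[OF mA] ind[OF mX] LX])
  also have "\<dots> = measure ?P ?X" by (rule int_ind[OF mX])
  finally show ?thesis .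
qed

section \<open>Exhaustion of a countable index set by finite ones\<close>

theorem gaussian_min_max_comparison:
  fixes a b :: "nat \<times> nat \<Rightarrow> 'i \<Rightarrow> real" and c :: "nat \<times> nat \<Rightarrow> real"
  assumes fin: "finite I"
    and disj: "\<And>p q i. a p i * b q i = 0"
    and cov_le: "\<And>p q. (\<Sum>i\<in>I. b p i * b q i) \<le> (\<Sum>i\<in>I. a p i * a q i)"
    and cov_eq: "\<And>p q. fst p = fst q \<Longrightarrow> (\<Sum>i\<in>I. b p i * b q i) = (\<Sum>i\<in>I. a p i * a q i)"
  shows "measure (std_normals I) {x \<in> space (std_normals I). \<forall>u. \<exists>v. c (u, v) < (\<Sum>i\<in>I. b (u, v) i * x i)}
    \<le> measure (std_normals I) {x \<in> space (std_normals I). \<forall>u. \<exists>v. c (u, v) \<le> (\<Sum>i\<in>I. a (u, v) i * x i)}"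
proof -
  interpret P: prob_space "std_normals I" by (rule prob_space_std_normals)
  let ?P = "std_normals I"
  \<comment> \<open>The order of the limits matters: for fixed K the events increase in L to the one
    with the full inner quantifier, and only then do these decrease in K.\<close>
  have lim: "(\<lambda>K. lim (\<lambda>L. measure ?P {x \<in> space ?P. \<forall>u\<in>{..<K}. \<exists>v\<in>{..<L}. Q (u, v) x})) \<longlonglongrightarrow>
      measure ?P {x \<in> space ?P. \<forall>u. \<exists>v. Q (u, v) x}"
    and conv: "convergent (\<lambda>L. measure ?P {x \<in> space ?P. \<forall>u\<in>{..<K}. \<exists>v\<in>{..<L}. Q (u, v) x})"
    if m: "\<And>p. {x \<in> space ?P. Q p x} \<in> sets ?P" for Q :: "nat \<times> nat \<Rightarrow> ('i \<Rightarrow> real) \<Rightarrow> bool" and K :: nat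
  proof -
    let ?S = "\<lambda>K L. {x \<in> space ?P. \<forall>u\<in>{..<K}. \<exists>v\<in>{..<L}. Q (u, v) x}"
    let ?T = "\<lambda>K. {x \<in> space ?P. \<forall>u\<in>{..<K}. \<exists>v. Q (u, v) x}"
    have S: "?S K L \<in> sets ?P" for K L
      by (intro sets.sets_Collect_finite_All sets.sets_Collect_finite_Ex m) auto
    have T: "?T K \<in> sets ?P" for K
      by (intro sets.sets_Collect_finite_All sets.sets_Collect_countable_Ex m) auto
    have 1: "(\<lambda>L. measure ?P (?S K L)) \<longlonglongrightarrow> measure ?P (?T K)" for K
    proof -
      have eq: "(\<Union>L. ?S K L) = ?T K"
      proof safe
        fix x assume x: "x \<in> space ?P" "\<forall>u\<in>{..<K}. \<exists>v. Q (u, v) x"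
        then obtain v where v: "\<And>u. u < K \<Longrightarrow> Q (u, v u) x" by (metis lessThan_iff)
        \<comment> \<open>Finitely many rows need finitely many witnesses, which have a common
          bound; the successor makes it strict.\<close>
        have "v u < Suc (Max (v ` {..<K}))" if "u < K" for u
          unfolding less_Suc_eq_le by (rule Max_ge) (use that in auto)
        then have "\<forall>u\<in>{..<K}. \<exists>v'\<in>{..<Suc (Max (v ` {..<K}))}. Q (u, v') x" using v by blast
        then show "x \<in> (\<Union>L. ?S K L)" using x by blast
      qed blast
      have inc: "incseq (?S K)" by (rule incseq_SucI) force
      have "range (?S K) \<subseteq> sets ?P" using S by blast
      from P.finite_Lim_measure_incseq[OF this inc] show ?thesis unfolding eq .
    qed
    have 2: "(\<lambda>K. measure ?P (?T K)) \<longlonglongrightarrow> measure ?P {x \<in> space ?P. \<forall>u. \<exists>v. Q (u, v) x}"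
    proof -
      have eq: "(\<Inter>K. ?T K) = {x \<in> space ?P. \<forall>u. \<exists>v. Q (u, v) x}" by auto
      have dec: "decseq ?T" by (rule decseq_SucI) auto
      have "range ?T \<subseteq> sets ?P" using T by blast
      from P.finite_Lim_measure_decseq[OF this dec] show ?thesis unfolding eq .
    qed
    show "(\<lambda>K. lim (\<lambda>L. measure ?P (?S K L))) \<longlonglongrightarrow> measure ?P {x \<in> space ?P. \<forall>u. \<exists>v. Q (u, v) x}"
      using 2 limI[OF 1] by simp
    show "convergent (\<lambda>L. measure ?P (?S K L))" using 1 by (rule convergentI)
  qed
  have mm: "{x \<in> space ?P. c p < (\<Sum>i\<in>I. b p i * x i)} \<in> sets ?P"
    "{x \<in> space ?P. c p \<le> (\<Sum>i\<in>I. a p i * x i)} \<in> sets ?P" for p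
    by (intro borel_measurable_less borel_measurable_le borel_measurable_sum borel_measurable_times
        borel_measurable_const measurable_std_normals_component; assumption)+
  show ?thesis
  proof (rule LIMSEQ_le[OF lim[OF mm(1)] lim[OF mm(2)]])
    have "lim (\<lambda>L. measure ?P {x \<in> space ?P. \<forall>u\<in>{..<K}. \<exists>v\<in>{..<L}. c (u, v) < (\<Sum>i\<in>I. b (u, v) i * x i)})
      \<le> lim (\<lambda>L. measure ?P {x \<in> space ?P. \<forall>u\<in>{..<K}. \<exists>v\<in>{..<L}. c (u, v) \<le> (\<Sum>i\<in>I. a (u, v) i * x i)})" for K
    proof (rule LIMSEQ_le)
      show "\<exists>N. \<forall>L\<ge>N.
        measure ?P {x \<in> space ?P. \<forall>u\<in>{..<K}. \<exists>v\<in>{..<L}. c (u, v) < (\<Sum>i\<in>I. b (u, v) i * x i)} \<le>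
        measure ?P {x \<in> space ?P. \<forall>u\<in>{..<K}. \<exists>v\<in>{..<L}. c (u, v) \<le> (\<Sum>i\<in>I. a (u, v) i * x i)}"
        by (intro exI[of _ 0] allI impI
            finite_gaussian_min_max_comparison[OF fin finite_lessThan finite_lessThan disj cov_le cov_eq])
    qed (use conv[OF mm(1), of K] conv[OF mm(2), of K] in \<open>simp_all only: convergent_LIMSEQ_iff\<close>)
    then show "\<exists>N. \<forall>K\<ge>N.
      lim (\<lambda>L. measure ?P {x \<in> space ?P. \<forall>u\<in>{..<K}. \<exists>v\<in>{..<L}. c (u, v) < (\<Sum>i\<in>I. b (u, v) i * x i)})
      \<le> lim (\<lambda>L. measure ?P {x \<in> space ?P. \<forall>u\<in>{..<K}. \<exists>v\<in>{..<L}. c (u, v) \<le> (\<Sum>i\<in>I. a (u, v) i * x i)})"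
      by blast
  qed
qed

section \<open>Escape of the column space from the cone\<close>

text \<open>The strict inequality makes the cone open and keeps the zero vector out of it. Openness
  lets rational vectors approximate its points from within the cone; the absence of zero ensures
  that u is nonzero whenever \<open>H u\<close> lies in it.\<close>

definition in_cone :: "nat \<Rightarrow> real \<Rightarrow> (nat \<Rightarrow> real) \<Rightarrow> bool" where
  "in_cone n \<alpha> w \<longleftrightarrow> l1_norm n w < \<alpha> * sqrt (real n) * L2_set w {..<n}"

text \<open>Unlike in \<open>column_space\<close>, the result is not cut off at n. The entries from
  n on are irrelevant to \<open>in_cone\<close>, and total functions are easier to pass to
  limits.\<close>

definition mat_vec :: "nat \<Rightarrow> (nat \<times> nat \<Rightarrow> real) \<Rightarrow> (nat \<Rightarrow> real) \<Rightarrow> nat \<Rightarrow> real" where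
  "mat_vec m A u = (\<lambda>i. \<Sum>j<m. A (i, j) * u j)"

definition avoids_cone :: "nat \<Rightarrow> nat \<Rightarrow> real \<Rightarrow> (nat \<times> nat \<Rightarrow> real) \<Rightarrow> bool" where
  "avoids_cone n m \<alpha> A \<longleftrightarrow> (\<forall>u. \<not> in_cone n \<alpha> (mat_vec m A u))"

definition rat_vecs :: "nat \<Rightarrow> (nat \<Rightarrow> real) set" where
  "rat_vecs n = {..<n} \<rightarrow>\<^sub>E \<rat>"

lemma in_cone_cong: "(\<And>i. i < n \<Longrightarrow> v i = w i) \<Longrightarrow> in_cone n \<alpha> v \<longleftrightarrow> in_cone n \<alpha> w"
  by (simp add: in_cone_def l1_norm_def L2_set_def)

lemma avoids_cone_cong:
  assumes "\<And>i j. i < n \<Longrightarrow> j < m \<Longrightarrow> A (i, j) = B (i, j)"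
  shows "avoids_cone n m \<alpha> A \<longleftrightarrow> avoids_cone n m \<alpha> B"
  unfolding avoids_cone_def mat_vec_def
  by (intro all_cong1 arg_cong[where f = Not] in_cone_cong sum.cong) (simp_all add: assms)

lemma avoids_cone_column_space:
  "avoids_cone n m \<alpha> A \<longleftrightarrow>
    (\<forall>w\<in>column_space n m A. l1_norm n w \<ge> \<alpha> * sqrt (real n) * L2_set w {..<n})"
proof -
  have "in_cone n \<alpha> (\<lambda>i\<in>{..<n}. \<Sum>j<m. A (i, j) * u j) \<longleftrightarrow> in_cone n \<alpha> (mat_vec m A u)" for u
    unfolding mat_vec_def by (rule in_cone_cong) simp
  then show ?thesis
    unfolding avoids_cone_def column_space_def by (simp add: not_less[symmetric] flip: in_cone_def)
qed

lemma in_cone_scale: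
  assumes "0 < t" shows "in_cone n \<alpha> (\<lambda>i. t * w i) \<longleftrightarrow> in_cone n \<alpha> w"
proof -
  have "l1_norm n (\<lambda>i. t * w i) = t * l1_norm n w"
    using assms by (simp add: l1_norm_def abs_mult sum_distrib_left)
  moreover have "L2_set (\<lambda>i. t * w i) {..<n} = t * L2_set w {..<n}"
    using assms by (simp add: L2_set_right_distrib)
  ultimately have "in_cone n \<alpha> (\<lambda>i. t * w i) \<longleftrightarrow>
      t * l1_norm n w < t * (\<alpha> * sqrt (real n) * L2_set w {..<n})"
    unfolding in_cone_def by (simp add: mult.left_commute)
  then show ?thesis using assms by (simp add: in_cone_def mult.assoc)
qed

section \<open>Countable dense families of vectors\<close>

lemma countable_rat_vecs: "countable (rat_vecs n)"
  unfolding rat_vecs_def by (intro countable_PiE) (auto simp: countable_rat)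

lemma rat_vecs_nonempty: "rat_vecs n \<noteq> {}"
  unfolding rat_vecs_def by (auto simp: PiE_eq_empty_iff)

lemma rat_vecs_dense:
  obtains r where "\<And>t. r t \<in> rat_vecs n" "\<And>i. i < n \<Longrightarrow> (\<lambda>t. r t i) \<longlonglongrightarrow> d i"
proof -
  have "\<exists>q\<in>\<rat>. d i < q \<and> q < d i + 1 / real (Suc t)" for i t
    by (rule Rats_dense_in_real) simp
  then obtain q where q: "\<And>i t. q i t \<in> \<rat>" "\<And>i t. d i < q i t" "\<And>i t. q i t < d i + 1 / real (Suc t)"
    by metis
  have "(\<lambda>t. q i t) \<longlonglongrightarrow> d i" for i
  proof (rule real_tendsto_sandwich)
    show "\<forall>\<^sub>F t in sequentially. d i \<le> q i t" using q(2) by (simp add: less_imp_le)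
    show "\<forall>\<^sub>F t in sequentially. q i t \<le> d i + 1 / real (Suc t)" using q(3) by (simp add: less_imp_le)
    show "(\<lambda>t. d i + 1 / real (Suc t)) \<longlonglongrightarrow> d i"
      using tendsto_add[OF tendsto_const[of "d i"] LIMSEQ_Suc[OF lim_1_over_n]] by simp
  qed simp
  then show ?thesis
    by (intro that[of "\<lambda>t. \<lambda>i\<in>{..<n}. q i t"]) (auto simp: rat_vecs_def q(1))
qed

lemma tendsto_L2_set:
  assumes "\<And>i. i < n \<Longrightarrow> ((\<lambda>t. r t i) \<longlongrightarrow> d i) F"
  shows "((\<lambda>t. L2_set (r t) {..<n}) \<longlongrightarrow> L2_set d {..<n}) F"
  unfolding L2_set_def by (intro tendsto_intros) (use assms in auto)

lemma tendsto_l1_norm: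
  assumes "\<And>i. i < n \<Longrightarrow> ((\<lambda>t. r t i) \<longlongrightarrow> d i) F"
  shows "((\<lambda>t. l1_norm n (r t)) \<longlongrightarrow> l1_norm n d) F"
  unfolding l1_norm_def by (intro tendsto_intros) (use assms in auto)

lemma eventually_less_limits:
  fixes f g :: "'a \<Rightarrow> real"
  assumes "(f \<longlongrightarrow> a) F" "(g \<longlongrightarrow> b) F" "a < b"
  shows "\<forall>\<^sub>F t in F. f t < g t"
proof -
  have "\<forall>\<^sub>F t in F. 0 < g t - f t"
    by (rule order_tendstoD(1)[OF tendsto_diff[OF assms(2,1)]]) (use assms(3) in simp)
  then show ?thesis by (simp add: algebra_simps)
qed

lemma eventually_in_cone:
  assumes r: "\<And>i. i < n \<Longrightarrow> ((\<lambda>t. r t i) \<longlongrightarrow> d i) F" and d: "in_cone n \<alpha> d"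
  shows "\<forall>\<^sub>F t in F. in_cone n \<alpha> (r t)"
  unfolding in_cone_def
  by (rule eventually_less_limits[OF tendsto_l1_norm[OF r] tendsto_mult[OF tendsto_const tendsto_L2_set[OF r]]])
     (use d in \<open>simp_all add: in_cone_def\<close>)

lemma tendsto_mat_vec:
  assumes "\<And>j. j < m \<Longrightarrow> ((\<lambda>t. r t j) \<longlongrightarrow> u j) F"
  shows "((\<lambda>t. mat_vec m A (r t) i) \<longlongrightarrow> mat_vec m A u i) F"
  unfolding mat_vec_def by (intro tendsto_intros) (use assms in auto)

text \<open>If \<open>A u\<close> lies in the open cone, so does \<open>A u'\<close> for a rational
  u' near u. The countable quantifier makes the escape event measurable.\<close>

lemma avoids_cone_rational:
  "avoids_cone n m \<alpha> A \<longleftrightarrow> (\<forall>u\<in>rat_vecs m. \<not> in_cone n \<alpha> (mat_vec m A u))"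
proof
  assume *: "\<forall>u\<in>rat_vecs m. \<not> in_cone n \<alpha> (mat_vec m A u)"
  show "avoids_cone n m \<alpha> A"
    unfolding avoids_cone_def
  proof (intro allI notI)
    fix u assume u: "in_cone n \<alpha> (mat_vec m A u)"
    obtain r where r: "\<And>t. r t \<in> rat_vecs m" "\<And>i. i < m \<Longrightarrow> (\<lambda>t. r t i) \<longlonglongrightarrow> u i"
      using rat_vecs_dense[of m u] by blast
    have "\<forall>\<^sub>F t in sequentially. in_cone n \<alpha> (mat_vec m A (r t))"
      by (rule eventually_in_cone[OF tendsto_mat_vec u]) (rule r(2))
    from eventually_happens'[OF sequentially_bot this] obtain t where "in_cone n \<alpha> (mat_vec m A (r t))" by blast
    then show False using * r(1) by blast
  qed
qed (simp add: avoids_cone_def)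

lemma measurable_avoids_cone:
  assumes "{..<n} \<times> {..<m} \<subseteq> J"
  shows "{x \<in> space (std_normals J). avoids_cone n m \<alpha> x} \<in> sets (std_normals J)"
proof -
  have e: "(\<lambda>x. mat_vec m x u i) \<in> borel_measurable (std_normals J)" if "i < n" for u i
    unfolding mat_vec_def
    by (intro borel_measurable_sum borel_measurable_times borel_measurable_const measurable_std_normals_component)
       (use assms that in auto)
  have l1: "(\<lambda>x. l1_norm n (mat_vec m x u)) \<in> borel_measurable (std_normals J)" for u
    unfolding l1_norm_def by (intro borel_measurable_sum borel_measurable_abs e) simp
  have sq: "(\<lambda>x. \<Sum>i<n. (mat_vec m x u i)\<^sup>2) \<in> borel_measurable (std_normals J)" for u
    by (intro borel_measurable_sum borel_measurable_power e) simp
  have L2: "(\<lambda>x. L2_set (mat_vec m x u) {..<n}) \<in> borel_measurable (std_normals J)" for u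
    unfolding L2_set_def by (rule measurable_compose[OF sq borel_measurable_sqrt])
  have "{x \<in> space (std_normals J). \<not> in_cone n \<alpha> (mat_vec m x u)} \<in> sets (std_normals J)" for u
    unfolding in_cone_def not_less
    by (rule borel_measurable_le[OF borel_measurable_times[OF borel_measurable_const L2] l1])
  then show ?thesis
    unfolding avoids_cone_rational
    by (intro sets.sets_Collect_countable_All' countable_rat_vecs)
qed

lemma inner_le_L2: "\<bar>\<Sum>i\<in>I. f i * g i\<bar> \<le> L2_set f I * L2_set g I"
  by (rule order_trans[OF sum_abs]) (simp add: abs_mult L2_set_mult_ineq)

lemma L2_set_sq: "L2_set f I * L2_set f I = (\<Sum>i\<in>I. f i * f i)"
  unfolding L2_set_def by (simp add: power2_eq_square sum_nonneg)

lemma sum_bordered: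
  fixes f :: "nat \<times> nat \<Rightarrow> real"
  shows "(\<Sum>p\<in>{..n} \<times> {..m}. f p) = (\<Sum>i<n. \<Sum>j<m. f (i, j)) + (\<Sum>i<n. f (i, m)) + (\<Sum>j<m. f (n, j)) + f (n, m)"
proof -
  have "(\<Sum>p\<in>{..n} \<times> {..m}. f p) = (\<Sum>i<Suc n. \<Sum>j<Suc m. f (i, j))"
    by (simp add: sum.cartesian_product lessThan_Suc_atMost)
  also have "\<dots> = (\<Sum>i<n. \<Sum>j<m. f (i, j)) + (\<Sum>i<n. f (i, m)) + (\<Sum>j<m. f (n, j)) + f (n, m)"
    by (simp add: sum.distrib)
  finally show ?thesis .
qed

text \<open>A bordered matrix holds all Gaussians at once: the block x (i, j)
  with i < n and j < m is the matrix H, the last column is a Gaussian vector h, the last row a Gaussian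
  vector g, and the corner an independent scalar z. The processes are
  v H u + |u||v| z and |u| (h v) + |v| (g u), with covariance difference (|u||u'| - u u') (|v||v'| - v v').\<close>

lemma escape_comparison:
  fixes n m :: nat and \<alpha> c :: real
  defines "I \<equiv> {..n} \<times> {..m}"
  assumes c: "0 < c"
    and Q: "\<And>x w. x \<in> Q \<Longrightarrow> in_cone n \<alpha> w \<Longrightarrow>
      c + L2_set (\<lambda>j. x (n, j)) {..<m} < L2_set (\<lambda>i. x (i, m) - w i) {..<n}"
    and Q_space: "Q \<subseteq> space (std_normals I)"
  shows "measure (std_normals I) Q \<le>
    measure (std_normals I) {x \<in> space (std_normals I). avoids_cone n m \<alpha> x} +
    measure (std_normals I) {x \<in> space (std_normals I). c \<le> x (n, m)}"
proof -
  interpret P: prob_space "std_normals I" by (rule prob_space_std_normals)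
  define e where "e k = from_nat_into (rat_vecs k)" for k
  have e: "e k l \<in> rat_vecs k" and e_onto: "v \<in> rat_vecs k \<Longrightarrow> \<exists>l. v = e k l" for k l v
    unfolding e_def using from_nat_into[OF rat_vecs_nonempty] from_nat_into_surj[OF countable_rat_vecs]
    by metis+
  \<comment> \<open>The outer index k encodes a pair of rational vectors: u in the domain of the
    matrix and w, the candidate point of the cone.\<close>
  define u where "u k = e m (fst (prod_decode k))" for k
  define w where "w k = e n (snd (prod_decode k))" for k
  have uw_onto: "\<exists>k. u k = u' \<and> w k = w'" if uw: "u' \<in> rat_vecs m" "w' \<in> rat_vecs n" for u' w'
  proof -
    obtain i j where "u' = e m i" "w' = e n j" using e_onto uw by metis
    then show ?thesis by (intro exI[of _ "prod_encode (i, j)"]) (simp add: u_def w_def)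
  qed
  define v where "v l = e n l" for l
  have v_onto: "\<exists>l. v l = v'" if "v' \<in> rat_vecs n" for v'
    using e_onto[OF that] by (auto simp: v_def)
  define nu where "nu k = L2_set (u k) {..<m}" for k
  define nv where "nv l = L2_set (v l) {..<n}" for l
  have nn: "0 \<le> nu k" "0 \<le> nv l" for k l by (simp_all add: nu_def nv_def)
  \<comment> \<open>\<open>a\<close> lives on the block and the corner, \<open>b\<close> on the last
    column and the last row. So the two processes share no Gaussian, and their supports are disjoint
    as the comparison requires.\<close>
  define a where "a p q = (if fst q < n \<and> snd q < m then v (snd p) (fst q) * u (fst p) (snd q)
      else if fst q = n \<and> snd q = m then nu (fst p) * nv (snd p) else 0)" for p q :: "nat \<times> nat"
  define b where "b p q = (if fst q < n \<and> snd q = m then nu (fst p) * v (snd p) (fst q)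
      else if fst q = n \<and> snd q < m then nv (snd p) * u (fst p) (snd q) else 0)" for p q :: "nat \<times> nat"
  \<comment> \<open>The threshold -1 makes the condition void for pairs with u = 0 or w outside the
    cone, as v = 0 already satisfies it. For the other pairs the threshold 1 rules out v = 0, where
    both processes vanish. The remaining value combines the shift v w with the margin c
    |u||v|.\<close>
  define th where "th p = (if \<not> (0 < nu (fst p) \<and> in_cone n \<alpha> (w (fst p))) then -1
      else if nv (snd p) = 0 then 1
      else c * (nu (fst p) * nv (snd p)) + (\<Sum>i<n. v (snd p) i * w (fst p) i))" for p
  have X: "(\<Sum>i\<in>I. a (k, l) i * x i) = (\<Sum>i<n. v l i * mat_vec m x (u k) i) + nu k * nv l * x (n, m)" for k l x
    unfolding I_def sum_bordered a_def mat_vec_def by (simp add: sum_distrib_left mult_ac)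
  have Y: "(\<Sum>i\<in>I. b (k, l) i * x i) = nu k * (\<Sum>i<n. v l i * x (i, m)) + nv l * (\<Sum>j<m. u k j * x (n, j))" for k l x
    unfolding I_def sum_bordered b_def by (simp add: sum_distrib_left mult_ac)
  have aa: "(\<Sum>i\<in>I. a p i * a q i) = (\<Sum>i<n. v (snd p) i * v (snd q) i) * (\<Sum>j<m. u (fst p) j * u (fst q) j)
      + nu (fst p) * nu (fst q) * (nv (snd p) * nv (snd q))" for p q
    unfolding I_def sum_bordered a_def sum_product by (simp add: mult_ac)
  have bb: "(\<Sum>i\<in>I. b p i * b q i) = nu (fst p) * nu (fst q) * (\<Sum>i<n. v (snd p) i * v (snd q) i)
      + nv (snd p) * nv (snd q) * (\<Sum>j<m. u (fst p) j * u (fst q) j)" for p q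
    unfolding I_def sum_bordered b_def by (simp add: sum_distrib_left mult_ac)
  have D: "(\<Sum>i\<in>I. a p i * a q i) - (\<Sum>i\<in>I. b p i * b q i) =
      (nu (fst p) * nu (fst q) - (\<Sum>j<m. u (fst p) j * u (fst q) j)) *
      (nv (snd p) * nv (snd q) - (\<Sum>i<n. v (snd p) i * v (snd q) i))" for p q
    unfolding aa bb by (simp add: algebra_simps)
  have comp: "measure (std_normals I) {x \<in> space (std_normals I). \<forall>k. \<exists>l. th (k, l) < (\<Sum>i\<in>I. b (k, l) i * x i)}
    \<le> measure (std_normals I) {x \<in> space (std_normals I). \<forall>k. \<exists>l. th (k, l) \<le> (\<Sum>i\<in>I. a (k, l) i * x i)}"
  proof (rule gaussian_min_max_comparison)
    show "finite I" by (simp add: I_def)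
    show "a p i * b q i = 0" for p q i unfolding a_def b_def by simp
    show "(\<Sum>i\<in>I. b p i * b q i) \<le> (\<Sum>i\<in>I. a p i * a q i)" for p q
    proof -
      have "(\<Sum>j<m. u (fst p) j * u (fst q) j) \<le> nu (fst p) * nu (fst q)"
        unfolding nu_def by (rule order_trans[OF abs_ge_self inner_le_L2])
      moreover have "(\<Sum>i<n. v (snd p) i * v (snd q) i) \<le> nv (snd p) * nv (snd q)"
        unfolding nv_def by (rule order_trans[OF abs_ge_self inner_le_L2])
      ultimately have "0 \<le> (\<Sum>i\<in>I. a p i * a q i) - (\<Sum>i\<in>I. b p i * b q i)"
        unfolding D by (intro mult_nonneg_nonneg) simp_all
      then show ?thesis by simp
    qed
    \<comment> \<open>Equal outer indices have the same u, so the first factor of the covariance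
      difference is zero.\<close>
    show "(\<Sum>i\<in>I. b p i * b q i) = (\<Sum>i\<in>I. a p i * a q i)" if "fst p = fst q" for p q
    proof -
      have "nu (fst q) * nu (fst q) = (\<Sum>j<m. u (fst q) j * u (fst q) j)"
        unfolding nu_def by (rule L2_set_sq)
      then have "(\<Sum>i\<in>I. a p i * a q i) - (\<Sum>i\<in>I. b p i * b q i) = 0"
        unfolding D that by simp
      then show ?thesis by simp
    qed
  qed
  have Y_event: "\<exists>l. th (k, l) < (\<Sum>i\<in>I. b (k, l) i * x i)" if x: "x \<in> Q" for x k
  proof (cases "0 < nu k \<and> in_cone n \<alpha> (w k)")
    case False
    define v0 where "v0 = (\<lambda>i\<in>{..<n}. 0 :: real)"
    have "v0 \<in> rat_vecs n" by (auto simp: v0_def rat_vecs_def)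
    then obtain l where "v l = v0" using v_onto by blast
    then have "(\<Sum>i<n. v l i * x (i, m)) = 0" "nv l = 0"
      by (simp_all add: v0_def nv_def L2_set_def)
    then have "(\<Sum>i\<in>I. b (k, l) i * x i) = 0" unfolding Y by simp
    then show ?thesis using False by (intro exI[of _ l]) (simp add: th_def)
  next
    case True
    \<comment> \<open>The best direction v is the residual of h from the cone point w / |u|;
      rescaling w by 1 / |u| does not leave the cone.\<close>
    define d where "d i = x (i, m) - (1 / nu k) * w k i" for i
    define g where "g = L2_set (\<lambda>j. x (n, j)) {..<m}"
    have nd: "c + g < L2_set d {..<n}"
      unfolding d_def g_def by (rule Q[OF x]) (use True in_cone_scale[of "1 / nu k" n \<alpha> "w k"] in simp)
    have g0: "0 \<le> g" by (simp add: g_def)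
    obtain r where r: "\<And>t. r t \<in> rat_vecs n" "\<And>i. i < n \<Longrightarrow> (\<lambda>t. r t i) \<longlonglongrightarrow> d i"
      using rat_vecs_dense[of n d] by blast
    \<comment> \<open>The margin by which v = y passes the threshold. At y = d the terms with h and
      w combine to |u||d|^2, and Cauchy-Schwarz on the term with g leaves at least |d||u| (|d| - |g|
      - c) > 0. By continuity a rational direction near d passes as well.\<close>
    define \<phi> where "\<phi> y = nu k * (\<Sum>i<n. y i * x (i, m)) + L2_set y {..<n} * (\<Sum>j<m. u k j * x (n, j))
        - (c * (nu k * L2_set y {..<n}) + (\<Sum>i<n. y i * w k i))" for y
    have "(\<lambda>t. \<phi> (r t)) \<longlonglongrightarrow> \<phi> d"
      unfolding \<phi>_def by (intro tendsto_intros tendsto_L2_set r(2)) simp_all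
    moreover have "0 < \<phi> d"
    proof -
      have "nu k * (\<Sum>i<n. d i * x (i, m)) - (\<Sum>i<n. d i * w k i) = nu k * (\<Sum>i<n. d i * d i)"
        unfolding sum_distrib_left sum_subtractf[symmetric]
        by (intro sum.cong refl) (use True in \<open>simp add: d_def field_simps\<close>)
      then have "\<phi> d = nu k * (L2_set d {..<n} * L2_set d {..<n}) + L2_set d {..<n} * (\<Sum>j<m. u k j * x (n, j))
          - c * (nu k * L2_set d {..<n})"
        unfolding \<phi>_def L2_set_sq by simp
      moreover have "- (nu k * g) \<le> (\<Sum>j<m. u k j * x (n, j))"
        using inner_le_L2[of "u k" "\<lambda>j. x (n, j)" "{..<m}"] unfolding nu_def g_def by linarith
      then have "L2_set d {..<n} * (- (nu k * g)) \<le> L2_set d {..<n} * (\<Sum>j<m. u k j * x (n, j))"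
        by (rule mult_left_mono) simp
      ultimately have "L2_set d {..<n} * nu k * (L2_set d {..<n} - g - c) \<le> \<phi> d"
        by (simp add: algebra_simps)
      moreover have "0 < L2_set d {..<n} * nu k * (L2_set d {..<n} - g - c)"
        using nd g0 c True by (intro mult_pos_pos) linarith+
      ultimately show ?thesis by linarith
    qed
    ultimately have 1: "\<forall>\<^sub>F t in sequentially. 0 < \<phi> (r t)" by (rule order_tendstoD)
    have "0 < L2_set d {..<n}" using nd g0 c by linarith
    then have "\<forall>\<^sub>F t in sequentially. 0 < L2_set (r t) {..<n}"
      using order_tendstoD(1)[OF tendsto_L2_set[of n r d]] r(2) by blast
    with 1 have "\<forall>\<^sub>F t in sequentially. 0 < \<phi> (r t) \<and> 0 < L2_set (r t) {..<n}" by (rule eventually_conj)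
    from eventually_happens'[OF sequentially_bot this] obtain t where t: "0 < \<phi> (r t)" "0 < L2_set (r t) {..<n}" by blast
    obtain l where l: "v l = r t" using v_onto[OF r(1)] by blast
    have "th (k, l) < (\<Sum>i\<in>I. b (k, l) i * x i)"
      unfolding Y using t True by (simp add: th_def \<phi>_def l[symmetric] nv_def)
    then show ?thesis by blast
  qed
  have X_event: "avoids_cone n m \<alpha> x \<or> c \<le> x (n, m)"
    if x: "\<forall>k. \<exists>l. th (k, l) \<le> (\<Sum>i\<in>I. a (k, l) i * x i)" for x
  proof (rule ccontr)
    assume "\<not> ?thesis"
    then obtain y where y: "in_cone n \<alpha> (mat_vec m x y)" and z: "x (n, m) < c"
      by (auto simp: avoids_cone_def)
    have "0 < L2_set y {..<m}"
    proof (rule ccontr)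
      assume "\<not> 0 < L2_set y {..<m}"
      then have "L2_set y {..<m} = 0" using L2_set_nonneg[of y "{..<m}"] by linarith
      then have "\<forall>j<m. y j = 0" by (simp add: L2_set_eq_0_iff)
      then have "mat_vec m x y i = 0" for i unfolding mat_vec_def by simp
      then have "in_cone n \<alpha> (\<lambda>_. 0)" using y in_cone_cong[of n "mat_vec m x y" "\<lambda>_. 0"] by simp
      then show False by (simp add: in_cone_def l1_norm_def L2_set_def)
    qed
    note ny = this
    \<comment> \<open>Both u and w have to be rational, and the image of a rational r need not be,
      so a rational s near \<open>H y\<close> serves as w. The defect |H r - s| tends to 0 while the
      slack (c - z) |r| tends to a positive limit. Once the defect is smaller than the slack,
      Cauchy-Schwarz forbids every v to reach its threshold.\<close>
    obtain r where r: "\<And>t. r t \<in> rat_vecs m" "\<And>i. i < m \<Longrightarrow> (\<lambda>t. r t i) \<longlonglongrightarrow> y i"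
      using rat_vecs_dense[of m y] by blast
    obtain s where s: "\<And>t. s t \<in> rat_vecs n" "\<And>i. i < n \<Longrightarrow> (\<lambda>t. s t i) \<longlonglongrightarrow> mat_vec m x y i"
      using rat_vecs_dense[of n "mat_vec m x y"] by blast
    have e1: "\<forall>\<^sub>F t in sequentially. in_cone n \<alpha> (s t)"
      by (rule eventually_in_cone[OF s(2) y])
    have e2: "\<forall>\<^sub>F t in sequentially. 0 < L2_set (r t) {..<m}"
      using order_tendstoD(1)[OF tendsto_L2_set[of m r y]] r(2) ny by blast
    have "(\<lambda>t. L2_set (\<lambda>i. mat_vec m x (r t) i - s t i) {..<n}) \<longlonglongrightarrow>
        L2_set (\<lambda>i. mat_vec m x y i - mat_vec m x y i) {..<n}"
      by (intro tendsto_L2_set tendsto_diff tendsto_mat_vec r(2) s(2))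
    then have "(\<lambda>t. L2_set (\<lambda>i. mat_vec m x (r t) i - s t i) {..<n}) \<longlonglongrightarrow> 0"
      by (simp add: L2_set_def)
    moreover have "(\<lambda>t. (c - x (n, m)) * L2_set (r t) {..<m}) \<longlonglongrightarrow> (c - x (n, m)) * L2_set y {..<m}"
      by (intro tendsto_intros tendsto_L2_set r(2))
    ultimately have e3: "\<forall>\<^sub>F t in sequentially.
        L2_set (\<lambda>i. mat_vec m x (r t) i - s t i) {..<n} < (c - x (n, m)) * L2_set (r t) {..<m}"
      by (rule eventually_less_limits) (use z ny in simp)
    have "\<forall>\<^sub>F t in sequentially. in_cone n \<alpha> (s t) \<and> 0 < L2_set (r t) {..<m} \<and>
        L2_set (\<lambda>i. mat_vec m x (r t) i - s t i) {..<n} < (c - x (n, m)) * L2_set (r t) {..<m}"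
      by (intro eventually_conj e1 e2 e3)
    from eventually_happens'[OF sequentially_bot this] obtain t where t: "in_cone n \<alpha> (s t)" "0 < L2_set (r t) {..<m}"
        "L2_set (\<lambda>i. mat_vec m x (r t) i - s t i) {..<n} < (c - x (n, m)) * L2_set (r t) {..<m}" by blast
    obtain k where k: "u k = r t" "w k = s t" using uw_onto[OF r(1) s(1)] by blast
    have nuk: "nu k = L2_set (r t) {..<m}" by (simp add: nu_def k)
    obtain l where "th (k, l) \<le> (\<Sum>i\<in>I. a (k, l) i * x i)" using x by blast
    then have l: "th (k, l) \<le> (\<Sum>i<n. v l i * mat_vec m x (r t) i) + nu k * nv l * x (n, m)"
      unfolding X k .
    have main: "0 < nu k \<and> in_cone n \<alpha> (w k)" using t by (simp add: nuk k)
    have "nv l \<noteq> 0"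
    proof
      assume "nv l = 0"
      moreover from this have "\<forall>i<n. v l i = 0" by (simp add: nv_def L2_set_eq_0_iff)
      ultimately show False using l main by (simp add: th_def)
    qed
    then have nvl: "0 < nv l" using nn(2)[of l] by linarith
    then have "c * (nu k * nv l) + (\<Sum>i<n. v l i * s t i) \<le>
        (\<Sum>i<n. v l i * mat_vec m x (r t) i) + nu k * nv l * x (n, m)"
      using l main by (simp add: th_def k)
    then have "nv l * ((c - x (n, m)) * nu k) \<le> (\<Sum>i<n. v l i * (mat_vec m x (r t) i - s t i))"
      by (simp add: algebra_simps sum_subtractf)
    also have "\<dots> \<le> nv l * L2_set (\<lambda>i. mat_vec m x (r t) i - s t i) {..<n}"
      unfolding nv_def by (rule order_trans[OF abs_ge_self inner_le_L2])
    also have "\<dots> < nv l * ((c - x (n, m)) * nu k)"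
      using t(3) nvl by (simp add: nuk)
    finally show False by simp
  qed
  have mb: "{x \<in> space (std_normals I). th p < (\<Sum>i\<in>I. b p i * x i)} \<in> sets (std_normals I)" for p
    by (intro borel_measurable_less borel_measurable_sum borel_measurable_times
        borel_measurable_const measurable_std_normals_component; assumption)+
  have good: "{x \<in> space (std_normals I). avoids_cone n m \<alpha> x} \<in> sets (std_normals I)"
    by (rule measurable_avoids_cone) (auto simp: I_def)
  have corner: "{x \<in> space (std_normals I). c \<le> x (n, m)} \<in> sets (std_normals I)"
    by (intro borel_measurable_le borel_measurable_const measurable_std_normals_component) (simp add: I_def)
  have "measure (std_normals I) Q \<le>
      measure (std_normals I) {x \<in> space (std_normals I). \<forall>k. \<exists>l. th (k, l) < (\<Sum>i\<in>I. b (k, l) i * x i)}"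
    by (rule P.finite_measure_mono)
       (use Y_event Q_space in blast, intro sets.sets_Collect_countable_All sets.sets_Collect_countable_Ex mb)
  also note comp
  also have "measure (std_normals I) {x \<in> space (std_normals I). \<forall>k. \<exists>l. th (k, l) \<le> (\<Sum>i\<in>I. a (k, l) i * x i)} \<le>
      measure (std_normals I) ({x \<in> space (std_normals I). avoids_cone n m \<alpha> x} \<union>
        {x \<in> space (std_normals I). c \<le> x (n, m)})"
    by (rule P.finite_measure_mono) (use X_event in blast, intro sets.Un good corner)
  also have "\<dots> \<le> measure (std_normals I) {x \<in> space (std_normals I). avoids_cone n m \<alpha> x} +
      measure (std_normals I) {x \<in> space (std_normals I). c \<le> x (n, m)}"
    by (rule measure_Un_le[OF good corner])
  finally show ?thesis .
qed

section \<open>Probability of the escape\<close>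

lemma measure_std_normal_UNIV [simp]: "measure std_normal UNIV = 1"
  using std_normal.prob_space by simp

lemma integral_std_normals_product:
  fixes h :: "real \<Rightarrow> real"
  assumes I: "finite I" "i \<in> I" "j \<in> I" "i \<noteq> j" and h: "integrable std_normal h"
  shows "integrable (std_normals I) (\<lambda>x. h (x i) * h (x j))"
    and "(\<integral>x. h (x i) * h (x j) \<partial>std_normals I) = (\<integral>x. h x \<partial>std_normal) * (\<integral>x. h x \<partial>std_normal)"
proof -
  define f where "f k = (if k = i \<or> k = j then h else (\<lambda>_. 1))" for k
  have p2: "(\<Prod>k\<in>I. a k) = a i * a j" if "\<And>k. k \<noteq> i \<Longrightarrow> k \<noteq> j \<Longrightarrow> a k = 1" for a :: "'a \<Rightarrow> real"
  proof -
    have "(\<Prod>k\<in>I. a k) = (\<Prod>k\<in>{i, j}. a k)"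
      by (rule prod.mono_neutral_right) (use I that in auto)
    then show ?thesis using I by simp
  qed
  have eq: "(\<lambda>x. \<Prod>k\<in>I. f k (x k)) = (\<lambda>x. h (x i) * h (x j))"
    by (rule ext, subst p2) (auto simp: f_def)
  have fi: "integrable std_normal (f k)" for k unfolding f_def using h by simp
  show "integrable (std_normals I) (\<lambda>x. h (x i) * h (x j))"
    using std_normal_product.product_integrable_prod[OF I(1), of f, OF fi] by (simp only: eq)
  have "(\<integral>x. h (x i) * h (x j) \<partial>std_normals I) = (\<Prod>k\<in>I. \<integral>x. f k x \<partial>std_normal)"
    using std_normal_product.product_integral_prod[OF I(1), of f, OF fi] by (simp only: eq)
  also have "\<dots> = (\<integral>x. h x \<partial>std_normal) * (\<integral>x. h x \<partial>std_normal)"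
    by (subst p2) (auto simp: f_def)
  finally show "(\<integral>x. h (x i) * h (x j) \<partial>std_normals I) =
    (\<integral>x. h x \<partial>std_normal) * (\<integral>x. h x \<partial>std_normal)" .
qed

text \<open>Distinct coordinates are independent, so the cross terms of the centred square integrate
  to zero and the variance grows linearly in \<open>card J\<close>. The subset \<open>J\<close> is
  there to single out the last column, the last row or the corner of the bordered matrix.\<close>

lemma std_normals_chebyshev:
  fixes f :: "real \<Rightarrow> real"
  assumes I: "finite I" "J \<subseteq> I" and f: "integrable std_normal f" "integrable std_normal (\<lambda>x. (f x)\<^sup>2)"
    and t: "0 < t"
  shows "measure (std_normals I) {x \<in> space (std_normals I).
      t \<le> \<bar>(\<Sum>j\<in>J. f (x j)) - real (card J) * (\<integral>x. f x \<partial>std_normal)\<bar>}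
    \<le> real (card J) * (\<integral>x. (f x - (\<integral>x. f x \<partial>std_normal))\<^sup>2 \<partial>std_normal) / t\<^sup>2"
proof -
  interpret P: prob_space "std_normals I" by (rule prob_space_std_normals)
  define \<mu> where "\<mu> = (\<integral>x. f x \<partial>std_normal)"
  define h where "h x = f x - \<mu>" for x
  have fJ: "finite J" using I finite_subset by blast
  have h1: "integrable std_normal h" unfolding h_def[abs_def] using f(1) by simp
  have h2: "integrable std_normal (\<lambda>x. h x * h x)"
  proof -
    have "(\<lambda>x. h x * h x) = (\<lambda>x. (f x)\<^sup>2 - 2 * \<mu> * f x + \<mu> * \<mu>)"
      by (rule ext) (simp add: h_def power2_eq_square algebra_simps)
    then show ?thesis using f by simp
  qed
  have h0: "(\<integral>x. h x \<partial>std_normal) = 0"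
    unfolding h_def using f(1) by (simp add: \<mu>_def)
  have fi: "integrable (std_normals I) (\<lambda>x. f (x j))" "(\<integral>x. f (x j) \<partial>std_normals I) = \<mu>" if "j \<in> J" for j
    using integrable_std_normals_component[of j I f] that I(2) f(1) by (auto simp: \<mu>_def)
  have hh: "integrable (std_normals I) (\<lambda>x. h (x i) * h (x j))"
    "(\<integral>x. h (x i) * h (x j) \<partial>std_normals I) = (if i = j then (\<integral>x. h x * h x \<partial>std_normal) else 0)"
    if ij: "i \<in> J" "j \<in> J" for i j
  proof -
    have "i \<in> I" "j \<in> I" using ij I(2) by auto
    then show "integrable (std_normals I) (\<lambda>x. h (x i) * h (x j))"
      "(\<integral>x. h (x i) * h (x j) \<partial>std_normals I) = (if i = j then (\<integral>x. h x * h x \<partial>std_normal) else 0)"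
      using integral_std_normals_product[OF I(1) _ _ _ h1, of i j]
        integrable_std_normals_component[of i I, OF _ h2] h0
      by (cases "i = j"; simp)+
  qed
  define S where "S x = (\<Sum>j\<in>J. f (x j))" for x
  have ES: "(\<integral>x. S x \<partial>std_normals I) = real (card J) * \<mu>"
    unfolding S_def using fi by simp
  have sq: "(S x - real (card J) * \<mu>)\<^sup>2 = (\<Sum>i\<in>J. \<Sum>j\<in>J. h (x i) * h (x j))" for x
    unfolding S_def h_def power2_eq_square sum_product[symmetric] by (simp add: sum_subtractf)
  have ESsq: "integrable (std_normals I) (\<lambda>x. (S x - real (card J) * \<mu>)\<^sup>2)"
    "(\<integral>x. (S x - real (card J) * \<mu>)\<^sup>2 \<partial>std_normals I) = real (card J) * (\<integral>x. h x * h x \<partial>std_normal)"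
    unfolding sq using hh fJ by simp_all
  have Sm: "integrable (std_normals I) S" unfolding S_def[abs_def] using fi(1) by simp
  have Ssq: "integrable (std_normals I) (\<lambda>x. (S x)\<^sup>2)"
  proof -
    have "(\<lambda>x. (S x)\<^sup>2) = (\<lambda>x. (S x - real (card J) * \<mu>)\<^sup>2 + 2 * (real (card J) * \<mu>) * S x - (real (card J) * \<mu>)\<^sup>2)"
      by (rule ext) (simp add: power2_eq_square algebra_simps)
    then show ?thesis using ESsq(1) Sm by simp
  qed
  have "measure (std_normals I) {x \<in> space (std_normals I). t \<le> \<bar>S x - real (card J) * \<mu>\<bar>}
      \<le> (\<integral>x. (S x - real (card J) * \<mu>)\<^sup>2 \<partial>std_normals I) / t\<^sup>2"
    using P.Chebyshev_inequality[OF borel_measurable_integrable[OF Sm] Ssq t] unfolding ES .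
  then show ?thesis
    unfolding ESsq(2) by (simp add: S_def h_def \<mu>_def power2_eq_square)
qed

text \<open>Second moment of the soft thresholding of a standard Gaussian at level u. For u \<ge> 0
  it is the expression under the root in \<open>g_obj\<close>.\<close>

definition shrink_moment :: "real \<Rightarrow> real" where
  "shrink_moment u = (\<integral>x. (max 0 (\<bar>x\<bar> - u))\<^sup>2 \<partial>std_normal)"

lemma shrink_le: "0 \<le> u \<Longrightarrow> (max 0 (\<bar>x\<bar> - u))\<^sup>2 \<le> x\<^sup>2" for x u :: real
  by (rule abs_le_square_iff[THEN iffD1]) auto

lemma integrable_shrink:
  assumes "0 \<le> u"
  shows "integrable std_normal (\<lambda>x. (max 0 (\<bar>x\<bar> - u))\<^sup>2)"
    "integrable std_normal (\<lambda>x. ((max 0 (\<bar>x\<bar> - u))\<^sup>2)\<^sup>2)"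
proof -
  have m: "(\<lambda>x. (max 0 (\<bar>x\<bar> - u))\<^sup>2) \<in> borel_measurable std_normal" by simp
  show "integrable std_normal (\<lambda>x. (max 0 (\<bar>x\<bar> - u))\<^sup>2)"
    by (rule Bochner_Integration.integrable_bound[OF integrable_std_normal_power[of 2] m AE_I2])
       (use shrink_le[OF assms] in simp)
  show "integrable std_normal (\<lambda>x. ((max 0 (\<bar>x\<bar> - u))\<^sup>2)\<^sup>2)"
  proof (rule Bochner_Integration.integrable_bound[OF integrable_std_normal_power[of 4] _ AE_I2])
    show "(\<lambda>x. ((max 0 (\<bar>x\<bar> - u))\<^sup>2)\<^sup>2) \<in> borel_measurable std_normal" by simp
    fix x :: real
    have "((max 0 (\<bar>x\<bar> - u))\<^sup>2)\<^sup>2 \<le> (x\<^sup>2)\<^sup>2"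
      by (rule power_mono[OF shrink_le[OF assms]]) simp
    then show "norm (((max 0 (\<bar>x\<bar> - u))\<^sup>2)\<^sup>2) \<le> norm (x ^ 4)"
      by simp
  qed
qed

lemma std_normal_second_moment: "(\<integral>x. x\<^sup>2 \<partial>std_normal) = 1"
  using integral_std_normal_moment_even[of 1] by (simp add: integral_std_normal fact_numeral)

lemma shrink_moment_nonneg: "0 \<le> shrink_moment u"
  unfolding shrink_moment_def by simp

text \<open>Lagrangian bound on the support function of the cone, u being the multiplier of the
  l1 constraint.\<close>

lemma cone_inner_le:
  assumes u: "0 \<le> u" and w: "l1_norm n w \<le> \<alpha> * sqrt (real n) * L2_set w {..<n}"
  shows "(\<Sum>i<n. h i * w i) \<le>
    (L2_set (\<lambda>i. max 0 (\<bar>h i\<bar> - u)) {..<n} + u * (\<alpha> * sqrt (real n))) * L2_set w {..<n}"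
proof -
  have "h i * w i \<le> max 0 (\<bar>h i\<bar> - u) * \<bar>w i\<bar> + u * \<bar>w i\<bar>" for i
  proof -
    have "h i * w i \<le> \<bar>h i\<bar> * \<bar>w i\<bar>" by (metis abs_ge_self abs_mult)
    also have "\<dots> \<le> (max 0 (\<bar>h i\<bar> - u) + u) * \<bar>w i\<bar>" by (rule mult_right_mono) auto
    finally show ?thesis by (simp add: distrib_right)
  qed
  then have "(\<Sum>i<n. h i * w i) \<le> (\<Sum>i<n. max 0 (\<bar>h i\<bar> - u) * \<bar>w i\<bar> + u * \<bar>w i\<bar>)"
    by (rule sum_mono)
  also have "\<dots> = (\<Sum>i<n. max 0 (\<bar>h i\<bar> - u) * \<bar>w i\<bar>) + u * l1_norm n w"
    by (simp add: sum.distrib sum_distrib_left l1_norm_def)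
  also have "\<dots> \<le> L2_set (\<lambda>i. max 0 (\<bar>h i\<bar> - u)) {..<n} * L2_set w {..<n}
      + u * (\<alpha> * sqrt (real n) * L2_set w {..<n})"
  proof (rule add_mono)
    show "(\<Sum>i<n. max 0 (\<bar>h i\<bar> - u) * \<bar>w i\<bar>) \<le> L2_set (\<lambda>i. max 0 (\<bar>h i\<bar> - u)) {..<n} * L2_set w {..<n}"
      using inner_le_L2[of "\<lambda>i. max 0 (\<bar>h i\<bar> - u)" "\<lambda>i. \<bar>w i\<bar>" "{..<n}"] by (simp add: L2_set_def)
    show "u * l1_norm n w \<le> u * (\<alpha> * sqrt (real n) * L2_set w {..<n})"
      by (rule mult_left_mono[OF w u])
  qed
  finally show ?thesis by (simp add: algebra_simps)
qed

text \<open>With q the dual bound per unit length of w, expanding the square leaves at least |h|^2 -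
  2 q |w| + |w|^2, and completing the square in |w| gives |h|^2 - q^2.\<close>

lemma cone_distance_ge:
  assumes u: "0 \<le> u" and w: "l1_norm n w \<le> \<alpha> * sqrt (real n) * L2_set w {..<n}"
  shows "(L2_set h {..<n})\<^sup>2 - (L2_set (\<lambda>i. max 0 (\<bar>h i\<bar> - u)) {..<n} + u * (\<alpha> * sqrt (real n)))\<^sup>2
    \<le> (L2_set (\<lambda>i. h i - w i) {..<n})\<^sup>2"
proof -
  define q where "q = L2_set (\<lambda>i. max 0 (\<bar>h i\<bar> - u)) {..<n} + u * (\<alpha> * sqrt (real n))"
  have "(L2_set (\<lambda>i. h i - w i) {..<n})\<^sup>2 =
      (L2_set h {..<n})\<^sup>2 - 2 * (\<Sum>i<n. h i * w i) + (L2_set w {..<n})\<^sup>2"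
    unfolding power2_eq_square L2_set_sq
    by (simp add: algebra_simps sum.distrib sum_subtractf sum_distrib_left)
  moreover have "(\<Sum>i<n. h i * w i) \<le> q * L2_set w {..<n}"
    unfolding q_def by (rule cone_inner_le[OF u w])
  moreover have "0 \<le> (q - L2_set w {..<n})\<^sup>2" by simp
  then have "2 * (q * L2_set w {..<n}) \<le> q\<^sup>2 + (L2_set w {..<n})\<^sup>2"
    by (simp add: power2_eq_square algebra_simps)
  ultimately show ?thesis unfolding q_def[symmetric] by linarith
qed

text \<open>The comparison is applied with c = \<epsilon> sqrt n. Its event \<open>Q\<close> is the
  one on which three sums of squares are within \<epsilon> n of their means. The constant K depends
  on \<alpha>, u and \<delta> only, so the failure probability decays like 1/n.\<close>

lemma avoids_cone_probability:
  fixes \<alpha> u \<delta> :: real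
  assumes \<alpha>: "0 < \<alpha>" and u: "0 \<le> u" and \<delta>: "0 < \<delta>" "\<delta> < 1"
    and gap: "sqrt (shrink_moment u) + \<alpha> * u < sqrt (1 - \<delta>)"
  obtains K where "\<And>n m. 0 < n \<Longrightarrow> real m = \<delta> * real n \<Longrightarrow>
    1 - K / real n \<le> measure (std_normals ({..n} \<times> {..m}))
      {x \<in> space (std_normals ({..n} \<times> {..m})). avoids_cone n m \<alpha> x}"
proof -
  define v where "v = shrink_moment u"
  have v0: "0 \<le> v" by (simp add: v_def shrink_moment_nonneg)
  \<comment> \<open>In units of sqrt n, a lower bound for dist(h, C) - |g| - c when the sums of
    squares are off by \<epsilon> n and c = \<epsilon> sqrt n. The gap condition says precisely that
    it is positive at \<epsilon> = 0; continuity then yields a positive \<epsilon>.\<close>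
  define \<Phi> where "\<Phi> \<epsilon> = sqrt (1 - \<epsilon> - (sqrt (v + \<epsilon>) + u * \<alpha>)\<^sup>2) - sqrt (\<delta> + \<epsilon>) - \<epsilon>" for \<epsilon>
  have "(sqrt v + u * \<alpha>)\<^sup>2 < (sqrt (1 - \<delta>))\<^sup>2"
    by (rule power_strict_mono) (use gap u \<alpha> v0 in \<open>simp_all add: v_def mult.commute\<close>)
  then have "\<delta> < 1 - (sqrt v + u * \<alpha>)\<^sup>2" using \<delta> by simp
  then have "0 < \<Phi> 0" by (simp add: \<Phi>_def)
  moreover have "isCont \<Phi> 0" unfolding \<Phi>_def by (intro continuous_intros)
  ultimately have "\<forall>\<^sub>F \<epsilon> in at 0. 0 < \<Phi> \<epsilon>"
    unfolding isCont_def by (rule order_tendstoD(1)[rotated])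
  then obtain d where d: "0 < d" "\<And>\<epsilon>. \<epsilon> \<noteq> 0 \<Longrightarrow> \<bar>\<epsilon>\<bar> < d \<Longrightarrow> 0 < \<Phi> \<epsilon>"
    unfolding eventually_at by (auto simp: dist_real_def)
  define \<epsilon> where "\<epsilon> = d / 2"
  have \<epsilon>: "0 < \<epsilon>" "0 < \<Phi> \<epsilon>" using d by (auto simp: \<epsilon>_def)
  define var where "var f = (\<integral>x. (f x - (\<integral>x. f x \<partial>std_normal))\<^sup>2 \<partial>std_normal)" for f :: "real \<Rightarrow> real"
  define f where "f x = (max 0 (\<bar>x\<bar> - u))\<^sup>2" for x
  define s where "s x = x\<^sup>2" for x :: real
  have var0: "0 \<le> var f" for f unfolding var_def by simp
  have int_f: "integrable std_normal f" "integrable std_normal (\<lambda>x. (f x)\<^sup>2)" "(\<integral>x. f x \<partial>std_normal) = v"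
    unfolding f_def using integrable_shrink[OF u] by (simp_all add: v_def shrink_moment_def)
  have int_s: "integrable std_normal s" "integrable std_normal (\<lambda>x. (s x)\<^sup>2)" "(\<integral>x. s x \<partial>std_normal) = 1"
    unfolding s_def using integrable_std_normal_power[of 2] integrable_std_normal_power[of 4]
      std_normal_second_moment by simp_all
  have int_id: "integrable std_normal (\<lambda>x. x)" "integrable std_normal (\<lambda>x. x\<^sup>2)"
    using integrable_std_normal_id integrable_std_normal_power[of 2] by simp_all
  \<comment> \<open>\<open>s\<close> counts twice, for |h|^2 and |g|^2; \<open>f\<close> belongs to
    the thresholded h and the identity to the corner z.\<close>
  define K where "K = (var s + var f + var s + var (\<lambda>x. x)) / \<epsilon>\<^sup>2"
  have "1 - K / real n \<le> measure (std_normals ({..n} \<times> {..m}))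
      {x \<in> space (std_normals ({..n} \<times> {..m})). avoids_cone n m \<alpha> x}"
    if n: "0 < n" and m: "real m = \<delta> * real n" for n m
  proof -
    define I where "I = {..n} \<times> {..m}"
    let ?P = "std_normals I"
    interpret P: prob_space ?P by (rule prob_space_std_normals)
    have fI: "finite I" by (simp add: I_def)
    \<comment> \<open>Index sets of the last column and the last row, which hold the vectors h and
      g; \<open>H\<close> is not the random matrix here.\<close>
    define H where "H = {..<n} \<times> {m}"
    define G where "G = {n} \<times> {..<m}"
    have sub: "H \<subseteq> I" "G \<subseteq> I" "{(n, m)} \<subseteq> I" by (auto simp: H_def G_def I_def)
    have card: "card H = n" "card G = m" by (simp_all add: H_def G_def card_cartesian_product)
    have sumH: "(\<Sum>p\<in>H. a p) = (\<Sum>i<n. a (i, m))" and sumG: "(\<Sum>p\<in>G. a p) = (\<Sum>j<m. a (n, j))"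
      for a :: "nat \<times> nat \<Rightarrow> real"
        by (simp_all add: H_def G_def sum.cartesian_product')
    define B where "B J h t = {x \<in> space ?P. t \<le> \<bar>(\<Sum>j\<in>J. h (x j)) - real (card J) * (\<integral>x. h x \<partial>std_normal)\<bar>}"
      for J and h :: "real \<Rightarrow> real" and t
    have B_sets: "B J h t \<in> sets ?P" if "J \<subseteq> I" "integrable std_normal h" for J h t
    proof -
      have "(\<lambda>x. \<Sum>j\<in>J. h (x j)) \<in> borel_measurable ?P"
        by (intro borel_measurable_sum borel_measurable_integrable integrable_std_normals_component(1))
           (use that in auto)
      then show ?thesis unfolding B_def by measurable
    qed
    have mn: "m \<le> n"
    proof -
      have "real m \<le> 1 * real n" unfolding m by (rule mult_right_mono) (use \<delta> in simp_all)
      then show ?thesis by simp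
    qed
    \<comment> \<open>Since m \<le> n, the deviations of the row can be measured on the scale of n
      as well.\<close>
    have cheb: "measure ?P (B J h (\<epsilon> * real n)) \<le> var h / \<epsilon>\<^sup>2 / real n"
      if J: "J \<subseteq> I" "card J \<le> n" and h: "integrable std_normal h" "integrable std_normal (\<lambda>x. (h x)\<^sup>2)" for J h
    proof -
      have "measure ?P (B J h (\<epsilon> * real n)) \<le> real (card J) * var h / (\<epsilon> * real n)\<^sup>2"
        unfolding B_def var_def by (rule std_normals_chebyshev[OF fI J(1) h]) (use \<epsilon> n in simp)
      also have "\<dots> \<le> real n * var h / (\<epsilon> * real n)\<^sup>2"
        by (intro divide_right_mono mult_right_mono var0) (use J(2) in simp_all)
      also have "\<dots> = var h / \<epsilon>\<^sup>2 / real n"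
        using n \<epsilon> by (simp add: power2_eq_square field_simps)
      finally show ?thesis .
    qed
    define Q where "Q = space ?P - (B H s (\<epsilon> * real n) \<union> B H f (\<epsilon> * real n) \<union> B G s (\<epsilon> * real n))"
    have Q_low: "1 - (var s / \<epsilon>\<^sup>2 / real n + var f / \<epsilon>\<^sup>2 / real n + var s / \<epsilon>\<^sup>2 / real n) \<le> measure ?P Q"
    proof -
      have b: "B H s (\<epsilon> * real n) \<in> sets ?P" "B H f (\<epsilon> * real n) \<in> sets ?P" "B G s (\<epsilon> * real n) \<in> sets ?P"
        by (rule B_sets[OF sub(1) int_s(1)], rule B_sets[OF sub(1) int_f(1)], rule B_sets[OF sub(2) int_s(1)])
      have "measure ?P (B H s (\<epsilon> * real n) \<union> B H f (\<epsilon> * real n) \<union> B G s (\<epsilon> * real n)) \<le>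
          measure ?P (B H s (\<epsilon> * real n)) + measure ?P (B H f (\<epsilon> * real n)) + measure ?P (B G s (\<epsilon> * real n))"
        by (rule order_trans[OF measure_Un_le add_right_mono[OF measure_Un_le]]) (intro sets.Un b)+
      also have "\<dots> \<le> var s / \<epsilon>\<^sup>2 / real n + var f / \<epsilon>\<^sup>2 / real n + var s / \<epsilon>\<^sup>2 / real n"
        by (intro add_mono cheb sub int_s int_f) (simp_all add: card mn)
      finally have "measure ?P (B H s (\<epsilon> * real n) \<union> B H f (\<epsilon> * real n) \<union> B G s (\<epsilon> * real n)) \<le>
        var s / \<epsilon>\<^sup>2 / real n + var f / \<epsilon>\<^sup>2 / real n + var s / \<epsilon>\<^sup>2 / real n" .
      moreover have "measure ?P Q = 1 - measure ?P (B H s (\<epsilon> * real n) \<union> B H f (\<epsilon> * real n) \<union> B G s (\<epsilon> * real n))"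
        unfolding Q_def by (rule P.prob_compl) (intro sets.Un b)
      ultimately show ?thesis by linarith
    qed
    have "measure ?P Q \<le> measure ?P {x \<in> space ?P. avoids_cone n m \<alpha> x} +
        measure ?P {x \<in> space ?P. \<epsilon> * sqrt (real n) \<le> x (n, m)}"
      unfolding I_def
    proof (rule escape_comparison)
      show "0 < \<epsilon> * sqrt (real n)" using \<epsilon> n by simp
      show "Q \<subseteq> space (std_normals ({..n} \<times> {..m}))" unfolding Q_def I_def by blast
      fix x w assume x: "x \<in> Q" and w: "in_cone n \<alpha> w"
      define h where "h i = x (i, m)" for i
      have "x \<notin> B H s (\<epsilon> * real n)" "x \<notin> B H f (\<epsilon> * real n)" "x \<notin> B G s (\<epsilon> * real n)" "x \<in> space ?P"
        using x by (auto simp: Q_def)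
      then have x1: "\<bar>(\<Sum>i<n. (h i)\<^sup>2) - real n\<bar> < \<epsilon> * real n"
        and x2: "\<bar>(\<Sum>i<n. (max 0 (\<bar>h i\<bar> - u))\<^sup>2) - real n * v\<bar> < \<epsilon> * real n"
        and x3: "\<bar>(\<Sum>j<m. (x (n, j))\<^sup>2) - real m\<bar> < \<epsilon> * real n"
        unfolding B_def by (simp_all add: sumH sumG card int_s int_f not_le h_def s_def f_def)
      define sn where "sn = sqrt (real n)"
      have sn: "0 < sn" "real n = sn * sn" using n by (simp_all add: sn_def)
      have g: "L2_set (\<lambda>j. x (n, j)) {..<m} \<le> sn * sqrt (\<delta> + \<epsilon>)"
      proof -
        have "(\<Sum>j<m. (x (n, j))\<^sup>2) \<le> real n * (\<delta> + \<epsilon>)" using x3 m by (simp add: algebra_simps)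
        then show ?thesis unfolding L2_set_def sn_def real_sqrt_mult[symmetric] by (rule real_sqrt_le_mono)
      qed
      have q: "L2_set (\<lambda>i. max 0 (\<bar>h i\<bar> - u)) {..<n} \<le> sn * sqrt (v + \<epsilon>)"
      proof -
        have "(\<Sum>i<n. (max 0 (\<bar>h i\<bar> - u))\<^sup>2) \<le> real n * (v + \<epsilon>)" using x2 by (simp add: algebra_simps)
        then show ?thesis unfolding L2_set_def sn_def real_sqrt_mult[symmetric] by (rule real_sqrt_le_mono)
      qed
      have "L2_set (\<lambda>i. max 0 (\<bar>h i\<bar> - u)) {..<n} + u * (\<alpha> * sqrt (real n)) \<le> sn * (sqrt (v + \<epsilon>) + u * \<alpha>)"
        using q by (simp add: sn_def[symmetric] algebra_simps)
      then have "(L2_set (\<lambda>i. max 0 (\<bar>h i\<bar> - u)) {..<n} + u * (\<alpha> * sqrt (real n)))\<^sup>2 \<le> (sn * (sqrt (v + \<epsilon>) + u * \<alpha>))\<^sup>2"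
        by (rule power_mono) (use u \<alpha> in simp)
      moreover have "(L2_set h {..<n})\<^sup>2 - (L2_set (\<lambda>i. max 0 (\<bar>h i\<bar> - u)) {..<n} + u * (\<alpha> * sqrt (real n)))\<^sup>2
          \<le> (L2_set (\<lambda>i. h i - w i) {..<n})\<^sup>2"
        by (rule cone_distance_ge[OF u]) (use w in \<open>simp add: in_cone_def\<close>)
      moreover have "(L2_set h {..<n})\<^sup>2 = (\<Sum>i<n. (h i)\<^sup>2)"
        by (simp add: L2_set_def sum_nonneg)
      ultimately have "real n * (1 - \<epsilon>) - (sn * (sqrt (v + \<epsilon>) + u * \<alpha>))\<^sup>2 \<le> (L2_set (\<lambda>i. h i - w i) {..<n})\<^sup>2"
        using x1 by (simp add: algebra_simps)
      then have "real n * (1 - \<epsilon> - (sqrt (v + \<epsilon>) + u * \<alpha>)\<^sup>2) \<le> (L2_set (\<lambda>i. h i - w i) {..<n})\<^sup>2"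
        by (simp add: power_mult_distrib sn_def right_diff_distrib)
      then have "sqrt (real n * (1 - \<epsilon> - (sqrt (v + \<epsilon>) + u * \<alpha>)\<^sup>2)) \<le> L2_set (\<lambda>i. h i - w i) {..<n}"
        using real_sqrt_le_mono by fastforce
      then have "sn * sqrt (1 - \<epsilon> - (sqrt (v + \<epsilon>) + u * \<alpha>)\<^sup>2) \<le> L2_set (\<lambda>i. h i - w i) {..<n}"
        unfolding real_sqrt_mult sn_def .
      moreover have "sn * (\<epsilon> + sqrt (\<delta> + \<epsilon>)) < sn * sqrt (1 - \<epsilon> - (sqrt (v + \<epsilon>) + u * \<alpha>)\<^sup>2)"
        using \<epsilon>(2) sn(1) by (intro mult_strict_left_mono) (simp_all add: \<Phi>_def)
      ultimately show "\<epsilon> * sqrt (real n) + L2_set (\<lambda>j. x (n, j)) {..<m} < L2_set (\<lambda>i. x (i, m) - w i) {..<n}"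
        using g unfolding h_def sn_def[symmetric] by (simp add: algebra_simps)
    qed
    moreover have "measure ?P {x \<in> space ?P. \<epsilon> * sqrt (real n) \<le> x (n, m)} \<le> var (\<lambda>x. x) / \<epsilon>\<^sup>2 / real n"
    proof -
      have id0: "(\<integral>x. x \<partial>std_normal) = 0"
        using integral_std_normal_moment_odd[of 0] by (simp add: integral_std_normal)
      \<comment> \<open>A single Gaussian is compared with \<epsilon> sqrt n rather than \<epsilon>
        n; after squaring, this again gives the order 1/n.\<close>
      have "measure ?P {x \<in> space ?P. \<epsilon> * sqrt (real n) \<le> x (n, m)} \<le> measure ?P (B {(n, m)} (\<lambda>x. x) (\<epsilon> * sqrt (real n)))"
        by (rule P.finite_measure_mono[OF _ B_sets[OF sub(3) int_id(1)]]) (auto simp: B_def id0)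
      also have "\<dots> \<le> real (card {(n, m)}) * var (\<lambda>x. x) / (\<epsilon> * sqrt (real n))\<^sup>2"
        unfolding B_def var_def by (rule std_normals_chebyshev[OF fI sub(3) int_id]) (use \<epsilon> n in simp)
      also have "\<dots> = var (\<lambda>x. x) / \<epsilon>\<^sup>2 / real n"
        by (simp add: power_mult_distrib)
      finally show ?thesis .
    qed
    moreover have "K / real n = var s / \<epsilon>\<^sup>2 / real n + var f / \<epsilon>\<^sup>2 / real n + var s / \<epsilon>\<^sup>2 / real n + var (\<lambda>x. x) / \<epsilon>\<^sup>2 / real n"
      unfolding K_def by (simp add: add_divide_distrib)
    ultimately show ?thesis using Q_low unfolding I_def by linarith
  qed
  then show ?thesis using that by blast
qed

section \<open>The function g and the Gaussian width\<close>

lemma integrable_gaussian_poly: "integrable lborel (\<lambda>x. std_normal_density x * (x - u)\<^sup>2)"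
proof -
  have "(\<lambda>x. std_normal_density x * (x - u)\<^sup>2) =
      (\<lambda>x. std_normal_density x * x ^ 2 - (2 * u) * (std_normal_density x * x ^ 1) + u\<^sup>2 * std_normal_density x)"
    by (rule ext) (simp add: power2_eq_square algebra_simps)
  then show ?thesis
    using integrable_std_normal_moment[of 2] integrable_std_normal_moment[of 1] by simp
qed

text \<open>The function \<open>- (x - 2 * u) * std_normal_density x\<close> has derivative
  \<open>((x - u)^2 - (1 + u^2)) * std_normal_density x\<close>; its boundary value at u yields the
  last term.\<close>

lemma gaussian_half_line_moment:
  "(LBINT x:{u<..}. std_normal_density x * (x - u)\<^sup>2) =
    (1 + u\<^sup>2) * (LBINT x:{u<..}. std_normal_density x) - u * std_normal_density u"
proof -
  let ?g = "\<lambda>x. std_normal_density x * (x - u)\<^sup>2 - (1 + u\<^sup>2) * std_normal_density x"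
  have i1: "set_integrable lborel {u<..} (\<lambda>x. std_normal_density x * (x - u)\<^sup>2)"
    and i2: "set_integrable lborel {u<..} std_normal_density"
    unfolding set_integrable_def
    by (intro integrable_mult_indicator integrable_gaussian_poly integrable_normal_density; simp)+
  have i3: "set_integrable lborel {u<..} (\<lambda>x. (1 + u\<^sup>2) * std_normal_density x)"
    using i2 by simp
  have "(LBINT x=ereal u..\<infinity>. ?g x) = 0 - (- (u - 2 * u) * std_normal_density u)"
  proof (rule interval_integral_FTC_integrable[where F = "\<lambda>x. - (x - 2 * u) * std_normal_density x"])
    show "((\<lambda>x. - (x - 2 * u) * std_normal_density x) has_vector_derivative ?g x) (at x)" for x
      unfolding has_real_derivative_iff_has_vector_derivative[symmetric]
      by (rule derivative_eq_intros std_normal_density_deriv refl | simp add: algebra_simps power2_eq_square)+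
    show "isCont ?g x" for x
      using DERIV_isCont[OF std_normal_density_deriv] by (auto intro!: continuous_intros)
    show "set_integrable lborel (einterval (ereal u) \<infinity>) ?g"
      using set_integral_diff(1)[OF i1 i3] by simp
    have "((\<lambda>x. - (x - 2 * u) * std_normal_density x) \<longlongrightarrow> - (u - 2 * u) * std_normal_density u) (at_right u)"
      by (intro tendsto_intros isCont_tendsto_compose[OF DERIV_isCont[OF std_normal_density_deriv]])
    then show "(((\<lambda>x. - (x - 2 * u) * std_normal_density x) \<circ> real_of_ereal) \<longlongrightarrow>
        - (u - 2 * u) * std_normal_density u) (at_right (ereal u))"
      by (simp add: ereal_tendsto_simps)
    have "((\<lambda>x. - (x - 2 * u) * std_normal_density x) \<longlongrightarrow> 0) at_top"
      unfolding std_normal_density_def by real_asymp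
    then show "(((\<lambda>x. - (x - 2 * u) * std_normal_density x) \<circ> real_of_ereal) \<longlongrightarrow> 0) (at_left \<infinity>)"
      by (simp add: ereal_tendsto_simps)
  qed simp
  then have "(LBINT x:{u<..}. ?g x) = - u * std_normal_density u"
    by (simp add: interval_integral_to_infinity_eq)
  then show ?thesis
    using set_integral_diff(2)[OF i1 i3] by simp
qed

text \<open>Substitution s = x / sqrt 2. The end point, a null set, is dropped to match the half
  line of the moment formula.\<close>

lemma erfc_eq_half_line:
  "erfc (u / sqrt 2) = 2 * (LBINT x:{u<..}. std_normal_density x)"
proof -
  have "(LBINT s:{u / sqrt 2..}. exp (- s\<^sup>2)) = (\<integral>s. indicator {u / sqrt 2..} s * exp (- s\<^sup>2) \<partial>lborel)"
    by (simp add: set_lebesgue_integral_def)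
  also have "\<dots> = \<bar>1 / sqrt 2\<bar> *\<^sub>R (\<integral>x. indicator {u / sqrt 2..} (0 + 1 / sqrt 2 * x) * exp (- (0 + 1 / sqrt 2 * x)\<^sup>2) \<partial>lborel)"
    by (rule lborel_integral_real_affine) simp
  also have "(\<lambda>x. indicator {u / sqrt 2..} (0 + 1 / sqrt 2 * x) * exp (- (0 + 1 / sqrt 2 * x)\<^sup>2)) =
      (\<lambda>x. sqrt (2 * pi) * (indicator {u..} x * std_normal_density x))"
    by (rule ext) (auto simp: std_normal_density_def indicator_def divide_simps power_divide power_mult_distrib)
  also have "(\<integral>x. sqrt (2 * pi) * (indicator {u..} x * std_normal_density x) \<partial>lborel) =
      sqrt (2 * pi) * (\<integral>x. indicator {u..} x * std_normal_density x \<partial>lborel)"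
    by simp
  also have "(\<integral>x. indicator {u..} x * std_normal_density x \<partial>lborel) =
      (\<integral>x. indicator {u<..} x * std_normal_density x \<partial>lborel)"
  proof (rule integral_cong_AE)
    have "AE x in lborel. x \<noteq> u" by (rule AE_lborel_singleton)
    then show "AE x in lborel. indicator {u..} x * std_normal_density x = indicator {u<..} x * std_normal_density x"
      by eventually_elim (auto simp: indicator_def)
  qed auto
  finally have "(LBINT s:{u / sqrt 2..}. exp (- s\<^sup>2)) = sqrt pi * (LBINT x:{u<..}. std_normal_density x)"
    by (simp add: set_lebesgue_integral_def real_sqrt_mult)
  then show ?thesis unfolding erfc_def by simp
qed

text \<open>The two tails |x| > u are mirror images and, as u \<ge> 0, disjoint, so the moment is
  twice that of the right tail. This is the link between the analytic formula for g and the
  probabilistic bounds.\<close>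

lemma shrink_moment_eq:
  assumes u: "0 \<le> u"
  shows "shrink_moment u = (u\<^sup>2 + 1) * erfc (u / sqrt 2) - sqrt (2 / pi) * u * exp (- u\<^sup>2 / 2)"
proof -
  let ?k = "\<lambda>x. indicator {u<..} x * (std_normal_density x * (x - u)\<^sup>2)"
  have ik: "integrable lborel ?k"
    using integrable_mult_indicator[OF _ integrable_gaussian_poly[of u], of "{u<..}"] by simp
  have k2: "(\<integral>x. ?k x \<partial>lborel) = (\<integral>x. ?k (- x) \<partial>lborel)"
    using lborel_integral_real_affine[of "-1" ?k 0] by simp
  have ik2: "integrable lborel (\<lambda>x. ?k (- x))"
    using lborel_integrable_real_affine[OF ik, of "-1" 0] by simp
  have "shrink_moment u = (\<integral>x. std_normal_density x * (max 0 (\<bar>x\<bar> - u))\<^sup>2 \<partial>lborel)"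
    unfolding shrink_moment_def by (rule integral_std_normal) simp
  also have "(\<lambda>x. std_normal_density x * (max 0 (\<bar>x\<bar> - u))\<^sup>2) = (\<lambda>x. ?k x + ?k (- x))"
  proof
    fix x :: real
    have "std_normal_density (- x) = std_normal_density x" by (simp add: std_normal_density_def)
    then show "std_normal_density x * (max 0 (\<bar>x\<bar> - u))\<^sup>2 = ?k x + ?k (- x)"
      using u by (auto simp: indicator_def max_def abs_if)
  qed
  also have "(\<integral>x. ?k x + ?k (- x) \<partial>lborel) = 2 * (\<integral>x. ?k x \<partial>lborel)"
    using ik ik2 k2 by simp
  also have "(\<integral>x. ?k x \<partial>lborel) = (LBINT x:{u<..}. std_normal_density x * (x - u)\<^sup>2)"
    by (simp add: set_lebesgue_integral_def)
  also have "2 * \<dots> = (u\<^sup>2 + 1) * erfc (u / sqrt 2) - u * (2 * std_normal_density u)"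
    unfolding gaussian_half_line_moment erfc_eq_half_line by (simp add: algebra_simps)
  also have "2 * std_normal_density u = sqrt (2 / pi) * exp (- u\<^sup>2 / 2)"
  proof -
    have "sqrt 2 * sqrt 2 = (2 :: real)" by simp
    then have "2 / sqrt (2 * pi) = sqrt (2 / pi)"
      unfolding real_sqrt_mult real_sqrt_divide by (simp add: field_simps)
    moreover have "2 * std_normal_density u = 2 / sqrt (2 * pi) * exp (- u\<^sup>2 / 2)"
      by (simp add: std_normal_density_def)
    ultimately show ?thesis by simp
  qed
  finally show ?thesis by (simp add: mult_ac)
qed

lemma g_obj_eq: "0 \<le> u \<Longrightarrow> g_obj \<alpha> u = sqrt (shrink_moment u) + \<alpha> * u"
  by (simp add: g_obj_def shrink_moment_eq)

text \<open>Pointwise, the thresholded square is at least x^2 - 2 u |x|, hence at least x^2 - u (1 +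
  x^2), which has mean 1 - 2 u. The bound controls minimisers u close to 0 when \<alpha> is
  large.\<close>

lemma shrink_moment_ge:
  assumes u: "0 \<le> u"
  shows "1 - 2 * u \<le> shrink_moment u"
proof -
  have i2: "integrable std_normal (\<lambda>x. x\<^sup>2)" by (rule integrable_std_normal_power)
  have "1 - 2 * u = (\<integral>x. x\<^sup>2 - u * (1 + x\<^sup>2) \<partial>std_normal)"
    using i2 by (simp add: std_normal_second_moment)
  also have "\<dots> \<le> shrink_moment u"
    unfolding shrink_moment_def
  proof (rule integral_mono)
    show "integrable std_normal (\<lambda>x. x\<^sup>2 - u * (1 + x\<^sup>2))" using i2 by simp
    fix x :: real
    have "0 \<le> (\<bar>x\<bar> - 1)\<^sup>2" by simp
    then have "2 * \<bar>x\<bar> \<le> 1 + x\<^sup>2" by (simp add: power2_eq_square algebra_simps)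
    then have 1: "u * (2 * \<bar>x\<bar>) \<le> u * (1 + x\<^sup>2)" using u by (rule mult_left_mono)
    have "x\<^sup>2 - u * (2 * \<bar>x\<bar>) \<le> (max 0 (\<bar>x\<bar> - u))\<^sup>2"
    proof (cases "u \<le> \<bar>x\<bar>")
      case True
      then have "(max 0 (\<bar>x\<bar> - u))\<^sup>2 = x\<^sup>2 - u * (2 * \<bar>x\<bar>) + u\<^sup>2"
        by (simp add: power2_eq_square algebra_simps)
      then show ?thesis by simp
    next
      case False
      then have "\<bar>x\<bar> * \<bar>x\<bar> \<le> \<bar>x\<bar> * (2 * u)" by (intro mult_left_mono) auto
      moreover have "\<bar>x\<bar> * \<bar>x\<bar> = x\<^sup>2" by (simp add: power2_eq_square)
      ultimately have "x\<^sup>2 - u * (2 * \<bar>x\<bar>) \<le> 0" by (simp add: mult_ac)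
      then show ?thesis using zero_le_power2 by (rule order_trans)
    qed
    with 1 show "x\<^sup>2 - u * (1 + x\<^sup>2) \<le> (max 0 (\<bar>x\<bar> - u))\<^sup>2" by linarith
  qed (rule integrable_shrink[OF u])
  finally show ?thesis .
qed

lemma shrink_moment_limit: "(\<lambda>k. shrink_moment (real k)) \<longlonglongrightarrow> 0"
proof -
  have "(\<lambda>k. \<integral>x. (max 0 (\<bar>x\<bar> - real k))\<^sup>2 \<partial>std_normal) \<longlonglongrightarrow> (\<integral>x. 0 \<partial>std_normal)"
  proof (rule integral_dominated_convergence)
    show "integrable std_normal (\<lambda>x. x\<^sup>2)" by (rule integrable_std_normal_power)
    show "AE x in std_normal. (\<lambda>k. (max 0 (\<bar>x\<bar> - real k))\<^sup>2) \<longlonglongrightarrow> 0"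
    proof (rule AE_I2)
      fix x :: real
      have "\<forall>\<^sub>F k in sequentially. \<bar>x\<bar> \<le> real k"
        by (rule eventually_sequentiallyI[of "nat \<lceil>\<bar>x\<bar>\<rceil>"]) linarith
      then have "\<forall>\<^sub>F k in sequentially. (max 0 (\<bar>x\<bar> - real k))\<^sup>2 = 0"
        by eventually_elim simp
      then show "(\<lambda>k. (max 0 (\<bar>x\<bar> - real k))\<^sup>2) \<longlonglongrightarrow> 0" by (rule tendsto_eventually)
    qed
    show "AE x in std_normal. norm ((max 0 (\<bar>x\<bar> - real k))\<^sup>2) \<le> x\<^sup>2" for k
      by (rule AE_I2) (simp add: shrink_le)
  qed simp_all
  then show ?thesis by (simp add: shrink_moment_def)
qed

section \<open>Threshold behaviour of g in the parameter \<alpha>\<close>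

lemma g_fun_le:
  assumes "0 < \<alpha>" "0 \<le> u"
  shows "g_fun \<alpha> \<le> g_obj \<alpha> u"
  using g_fun_minimum[OF assms(1)] assms(2) by metis

text \<open>A large u makes the root small, and then a small \<alpha> makes \<alpha> u small. This
  shows that the set defining \<open>alpha_star\<close> is not empty.\<close>

lemma g_fun_small:
  assumes "0 < s"
  obtains \<alpha> where "0 < \<alpha>" "g_fun \<alpha> < s"
proof -
  have "(\<lambda>k. sqrt (shrink_moment (real k))) \<longlonglongrightarrow> sqrt 0"
    by (intro tendsto_real_sqrt shrink_moment_limit)
  then have "\<forall>\<^sub>F k in sequentially. sqrt (shrink_moment (real k)) < s / 2"
    by (rule order_tendstoD) (use assms in simp)
  from eventually_happens'[OF sequentially_bot this]
  obtain k where k: "sqrt (shrink_moment (real k)) < s / 2" by blast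
  define \<alpha> where "\<alpha> = s / (2 * (real k + 1))"
  have \<alpha>: "0 < \<alpha>" using assms by (simp add: \<alpha>_def)
  have "\<alpha> * real k \<le> \<alpha> * (real k + 1)" using \<alpha> by (intro mult_left_mono) auto
  also have "\<dots> = s / 2" by (simp add: \<alpha>_def field_simps)
  finally have "g_obj \<alpha> (real k) < s" using k by (simp add: g_obj_eq)
  then show ?thesis using that \<alpha> g_fun_le[OF \<alpha>, of "real k"] by fastforce
qed

text \<open>This bounds the set defining \<open>alpha_star\<close>. If the minimiser u is at most
  \<delta> / 2, the root alone is at least sqrt (1 - \<delta>); otherwise \<alpha> \<ge> 2 /
  \<delta> forces \<alpha> u \<ge> 1.\<close>

lemma g_fun_large:
  assumes \<delta>: "0 < \<delta>" "\<delta> < 1" and \<alpha>: "2 / \<delta> \<le> \<alpha>"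
  shows "sqrt (1 - \<delta>) \<le> g_fun \<alpha>"
proof -
  have \<alpha>0: "0 < \<alpha>" using \<delta> \<alpha> by (meson divide_pos_pos order_less_le_trans zero_less_numeral)
  obtain u where u: "0 \<le> u" "g_fun \<alpha> = g_obj \<alpha> u" using g_fun_minimum[OF \<alpha>0] by metis
  show ?thesis
  proof (cases "u \<le> \<delta> / 2")
    case True
    then have "sqrt (1 - \<delta>) \<le> sqrt (shrink_moment u)"
      using shrink_moment_ge[OF u(1)] by simp
    also have "\<dots> \<le> g_fun \<alpha>" using u \<alpha>0 by (simp add: g_obj_eq)
    finally show ?thesis .
  next
    case False
    then have "1 \<le> \<alpha> * u"
      using mult_mono[OF \<alpha>, of "\<delta> / 2" u] \<delta> \<alpha>0 by simp
    also have "\<dots> \<le> g_fun \<alpha>" using u by (simp add: g_obj_eq shrink_moment_nonneg)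
    finally have "1 \<le> g_fun \<alpha>" .
    moreover have "sqrt (1 - \<delta>) \<le> 1" using \<delta> by simp
    ultimately show ?thesis by linarith
  qed
qed

lemma g_fun_mono:
  assumes "0 < \<alpha>" "\<alpha> \<le> \<beta>"
  shows "g_fun \<alpha> \<le> g_fun \<beta>"
proof -
  have "0 < \<beta>" using assms by simp
  then obtain u where u: "0 \<le> u" "g_fun \<beta> = g_obj \<beta> u" using g_fun_minimum by metis
  have "g_fun \<alpha> \<le> g_obj \<alpha> u" by (rule g_fun_le[OF assms(1) u(1)])
  also have "\<dots> \<le> g_obj \<beta> u" using assms u(1) by (simp add: g_obj_eq mult_right_mono)
  finally show ?thesis using u(2) by simp
qed

text \<open>For the minimiser u at \<alpha>, the affine function \<beta> \<mapsto>
  \<open>g_obj \<beta> u\<close> lies above \<open>g_fun\<close> and touches it at \<alpha>; a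
  strict inequality there persists a little to the right.\<close>

lemma g_fun_less_right:
  assumes "0 < \<alpha>" "g_fun \<alpha> < s"
  obtains \<beta> where "\<alpha> < \<beta>" "g_fun \<beta> < s"
proof -
  obtain u where u: "0 \<le> u" "g_fun \<alpha> = g_obj \<alpha> u" using g_fun_minimum[OF assms(1)] by metis
  \<comment> \<open>Raising \<alpha> by \<eta> costs \<eta> u, at most half of the available slack;
    the summand 1 avoids division by zero when u = 0.\<close>
  define \<eta> where "\<eta> = (s - g_fun \<alpha>) / (2 * (u + 1))"
  have \<eta>: "0 < \<eta>" using assms(2) u(1) by (simp add: \<eta>_def)
  have "\<eta> * u \<le> \<eta> * (u + 1)" using \<eta> by (intro mult_left_mono) auto
  also have "\<dots> = (s - g_fun \<alpha>) / 2" using u(1) by (simp add: \<eta>_def field_simps)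
  also have "\<dots> < s - g_fun \<alpha>" using assms(2) by simp
  finally have "g_obj (\<alpha> + \<eta>) u < s" using u by (simp add: g_obj_eq algebra_simps)
  moreover have "g_fun (\<alpha> + \<eta>) \<le> g_obj (\<alpha> + \<eta>) u" by (rule g_fun_le) (use assms \<eta> u in simp_all)
  ultimately show ?thesis using that[of "\<alpha> + \<eta>"] \<eta> by simp
qed

text \<open>Monotonicity makes the admissible \<alpha> an initial interval of the positive reals,
  and persistence to the right keeps the supremum out of it.\<close>

lemma alpha_star_properties:
  assumes \<delta>: "0 < \<delta>" "\<delta> < 1"
  shows "0 < alpha_star \<delta>"
    and "0 < \<alpha> \<Longrightarrow> g_fun \<alpha> < sqrt (1 - \<delta>) \<longleftrightarrow> \<alpha> < alpha_star \<delta>"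
proof -
  define S where "S = {\<alpha>. 0 < \<alpha> \<and> g_fun \<alpha> < sqrt (1 - \<delta>)}"
  have sup: "alpha_star \<delta> = Sup S" by (simp add: alpha_star_def S_def)
  have bdd: "bdd_above S"
  proof (rule bdd_aboveI)
    fix \<alpha> assume "\<alpha> \<in> S"
    then have "\<not> 2 / \<delta> \<le> \<alpha>" using g_fun_large[OF \<delta>, of \<alpha>] by (auto simp: S_def)
    then show "\<alpha> \<le> 2 / \<delta>" by simp
  qed
  obtain \<alpha>0 where \<alpha>0: "\<alpha>0 \<in> S" using g_fun_small[of "sqrt (1 - \<delta>)"] \<delta> by (auto simp: S_def)
  show "0 < alpha_star \<delta>"
    using cSup_upper[OF \<alpha>0 bdd] \<alpha>0 by (simp add: sup S_def)
  show "g_fun \<alpha> < sqrt (1 - \<delta>) \<longleftrightarrow> \<alpha> < alpha_star \<delta>" if \<alpha>: "0 < \<alpha>"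
  proof
    assume "g_fun \<alpha> < sqrt (1 - \<delta>)"
    then obtain \<beta> where "\<alpha> < \<beta>" "g_fun \<beta> < sqrt (1 - \<delta>)" using g_fun_less_right[OF \<alpha>] by blast
    moreover from this have "\<beta> \<le> Sup S" using \<alpha> by (intro cSup_upper bdd) (simp add: S_def)
    ultimately show "\<alpha> < alpha_star \<delta>" by (simp add: sup)
  next
    assume "\<alpha> < alpha_star \<delta>"
    then obtain \<beta> where "\<beta> \<in> S" "\<alpha> < \<beta>" unfolding sup using less_cSupE \<alpha>0 by blast
    then show "g_fun \<alpha> < sqrt (1 - \<delta>)" using g_fun_mono[OF \<alpha>, of \<beta>] by (simp add: S_def)
  qed
qed

section \<open>The bound on the Gaussian width\<close>

lemma integral_le_sqrt_second_moment:
  fixes f :: "'a \<Rightarrow> real"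
  assumes "prob_space M" "integrable M f" "integrable M (\<lambda>x. (f x)\<^sup>2)"
  shows "(\<integral>x. f x \<partial>M) \<le> sqrt (\<integral>x. (f x)\<^sup>2 \<partial>M)"
proof -
  interpret prob_space M by fact
  have "0 \<le> variance f" by (rule variance_positive)
  also have "variance f = (\<integral>x. (f x)\<^sup>2 \<partial>M) - (\<integral>x. f x \<partial>M)\<^sup>2"
    by (rule variance_eq[OF assms(2,3)])
  finally show ?thesis by (intro real_le_rsqrt) simp
qed

text \<open>The dual bound with the minimiser u holds for every h. Taking means, the first moment of
  the thresholded norm is at most the root of its second moment, which is n times
  \<open>shrink_moment u\<close>.\<close>

lemma gaussian_width_le:
  assumes \<alpha>: "0 < \<alpha>" and n: "0 < n" "1 < \<alpha> * sqrt (real n)"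
  shows "gaussian_width n (S_set n \<alpha>) \<le> g_fun \<alpha> * sqrt (real n)"
proof -
  interpret P: prob_space "std_normals {..<n}" by (rule prob_space_std_normals)
  obtain u where u: "0 \<le> u" "g_fun \<alpha> = g_obj \<alpha> u" using g_fun_minimum[OF \<alpha>] by metis
  define q where "q h = L2_set (\<lambda>i. max 0 (\<bar>h i\<bar> - u)) {..<n}" for h :: "nat \<Rightarrow> real"
  have q_sq: "(q h)\<^sup>2 = (\<Sum>i<n. (max 0 (\<bar>h i\<bar> - u))\<^sup>2)" for h
    unfolding q_def L2_set_def by (simp add: sum_nonneg)
  have int_sq: "integrable (std_normals {..<n}) (\<lambda>h. (q h)\<^sup>2)"
    "(\<integral>h. (q h)\<^sup>2 \<partial>std_normals {..<n}) = real n * shrink_moment u"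
  proof -
    note c = integrable_std_normals_component[OF _ integrable_shrink(1)[OF u(1)], of _ "{..<n}"]
    show "integrable (std_normals {..<n}) (\<lambda>h. (q h)\<^sup>2)"
      unfolding q_sq by (rule Bochner_Integration.integrable_sum) (rule c(1))
    show "(\<integral>h. (q h)\<^sup>2 \<partial>std_normals {..<n}) = real n * shrink_moment u"
      unfolding q_sq by (subst Bochner_Integration.integral_sum[OF c(1)]) (simp_all add: c(2) shrink_moment_def)
  qed
  have q_meas: "q \<in> borel_measurable (std_normals {..<n})"
    unfolding q_def[abs_def] L2_set_def
    by (rule measurable_compose[OF borel_measurable_integrable[OF int_sq(1)[unfolded q_sq]] borel_measurable_sqrt])
  have int_q: "integrable (std_normals {..<n}) q"
  proof (rule Bochner_Integration.integrable_bound[OF _ q_meas AE_I2])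
    show "integrable (std_normals {..<n}) (\<lambda>h. 1 + (q h)\<^sup>2)" using int_sq(1) by simp
    fix h
    have "0 \<le> (q h - 1)\<^sup>2" by simp
    moreover have "0 \<le> q h" by (simp add: q_def)
    ultimately show "norm (q h) \<le> norm (1 + (q h)\<^sup>2)" by (simp add: power2_eq_square algebra_simps)
  qed
  let ?w = "\<lambda>h. SUP w\<in>S_set n \<alpha>. \<Sum>i<n. h i * w i"
  \<comment> \<open>A coordinate vector has l1 norm 1, so it belongs to the set once 1 < \<alpha>
    sqrt n. A supremum over the empty set would admit no such bound.\<close>
  have ne: "S_set n \<alpha> \<noteq> {}"
  proof -
    define e where "e = (\<lambda>i\<in>{..<n}. if i = 0 then 1 else 0 :: real)"
    have "(\<Sum>i<n. \<bar>e i\<bar>) = 1" "(\<Sum>i<n. (e i)\<^sup>2) = 1"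
      using n(1) by (simp_all add: e_def sum_eq_single[of "{..<n}" 0])
    then have "e \<in> S_set n \<alpha>"
      using n(2) by (simp add: S_set_def unit_sphere_def l1_norm_def L2_set_def) (simp add: e_def)
    then show ?thesis by blast
  qed
  have le: "?w h \<le> q h + u * (\<alpha> * sqrt (real n))" for h
  proof (rule cSUP_least[OF ne])
    fix w assume w: "w \<in> S_set n \<alpha>"
    then have "L2_set w {..<n} = 1" by (simp add: S_set_def unit_sphere_def)
    then show "(\<Sum>i<n. h i * w i) \<le> q h + u * (\<alpha> * sqrt (real n))"
      using cone_inner_le[OF u(1), of n w \<alpha> h] w by (simp add: S_set_def q_def)
  qed
  have g: "g_fun \<alpha> * sqrt (real n) = sqrt (real n * shrink_moment u) + u * (\<alpha> * sqrt (real n))"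
    unfolding u(2) g_obj_eq[OF u(1)] real_sqrt_mult by (simp add: algebra_simps)
  show ?thesis
  proof (cases "integrable (std_normals {..<n}) ?w")
    case True
    have "gaussian_width n (S_set n \<alpha>) \<le> (\<integral>h. q h + u * (\<alpha> * sqrt (real n)) \<partial>std_normals {..<n})"
      unfolding gaussian_width_def std_gaussian_def
      by (rule integral_mono[OF True]) (use int_q le in simp_all)
    also have "\<dots> = (\<integral>h. q h \<partial>std_normals {..<n}) + u * (\<alpha> * sqrt (real n))"
      using int_q by (simp add: P.prob_space)
    also have "\<dots> \<le> g_fun \<alpha> * sqrt (real n)"
      using integral_le_sqrt_second_moment[OF prob_space_std_normals int_q int_sq(1)]
      unfolding g int_sq(2) by simp
    finally show ?thesis .
  next
    \<comment> \<open>The integral of a function that is not integrable is 0 by convention, and the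
      right-hand side is nonnegative. Thus measurability of the supremum need not be shown.\<close>
    case False
    then have "gaussian_width n (S_set n \<alpha>) = 0"
      unfolding gaussian_width_def std_gaussian_def by (rule not_integrable_integral_eq)
    also have "0 \<le> g_fun \<alpha> * sqrt (real n)"
      unfolding g using u(1) \<alpha> by (simp add: shrink_moment_nonneg)
    finally show ?thesis .
  qed
qed

text \<open>Both sides equal the probability of the escape under the product law on the n by m
  block: on the left it is the joint law of the independent entries, on the right the marginal of
  the bordered matrix.\<close>

lemma gaussian_matrix_avoids_cone:
  assumes H: "gaussian_matrix M n m H" and n: "0 < n" and m: "0 < m"
  shows "measure M {\<omega> \<in> space M. \<forall>w\<in>column_space n m (\<lambda>p. H p \<omega>).
      l1_norm n w \<ge> \<alpha> * sqrt (real n) * L2_set w {..<n}} =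
    measure (std_normals ({..n} \<times> {..m})) {x \<in> space (std_normals ({..n} \<times> {..m})). avoids_cone n m \<alpha> x}"
proof -
  define J where "J = {..<n} \<times> {..<m}"
  define I where "I = {..n} \<times> {..m}"
  have JI: "J \<subseteq> I" by (auto simp: J_def I_def)
  interpret M: prob_space M using H by (simp add: gaussian_matrix_def)
  note H' = H[unfolded gaussian_matrix_def]
  note indep = conjunct1[OF conjunct2[OF H'], folded J_def]
  note density = bspec[OF conjunct2[OF conjunct2[OF H']], folded J_def]
  have rv: "H p \<in> borel_measurable M" if "p \<in> J" for p
  proof -
    have "measurable M lborel = measurable M (borel :: real measure)"
      by (rule measurable_cong_sets[OF refl sets_lborel])
    with distributed_measurable[OF density[OF that]] show ?thesis by (metis (no_types))
  qed
  have dist: "distr M borel (H p) = std_normal" if "p \<in> J" for p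
  proof -
    have "distr M borel (H p) = distr M lborel (H p)" by (rule distr_cong) simp_all
    also have "\<dots> = std_normal" by (rule distributed_distr_eq_density[OF density[OF that]])
    finally show ?thesis .
  qed
  have ne: "J \<noteq> {}" using n m by (auto simp: J_def)
  define X where "X \<omega> = (\<lambda>p\<in>J. H p \<omega>)" for \<omega>
  have "distr M (\<Pi>\<^sub>M p\<in>J. borel) X = (\<Pi>\<^sub>M p\<in>J. distr M borel (H p))"
    unfolding X_def[abs_def] by (rule M.indep_vars_iff_distr_eq_PiM'[OF ne rv, THEN iffD1, OF _ indep])
  also have "\<dots> = std_normals J" by (rule PiM_cong) (simp_all add: dist)
  finally have dX: "distr M (\<Pi>\<^sub>M p\<in>J. borel) X = std_normals J" .
  have sets_eq: "sets (\<Pi>\<^sub>M p\<in>J. borel :: real measure) = sets (std_normals J)"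
    by (rule sets_PiM_cong) simp_all
  have mX: "X \<in> measurable M (\<Pi>\<^sub>M p\<in>J. borel)"
    unfolding X_def[abs_def] by (rule measurable_restrict) (rule rv)
  let ?G = "\<lambda>J. {x \<in> space (std_normals J). avoids_cone n m \<alpha> x}"
  have GJ: "?G J \<in> sets (std_normals J)" by (rule measurable_avoids_cone) (simp add: J_def)
  have "measure (std_normals J) (?G J) = measure (distr M (\<Pi>\<^sub>M p\<in>J. borel) X) (?G J)" by (simp add: dX)
  also have "\<dots> = measure M (X -` ?G J \<inter> space M)"
    by (rule measure_distr[OF mX]) (use GJ sets_eq in simp)
  also have "X -` ?G J \<inter> space M = {\<omega> \<in> space M. avoids_cone n m \<alpha> (\<lambda>p. H p \<omega>)}"
  proof -
    have "avoids_cone n m \<alpha> (X \<omega>) \<longleftrightarrow> avoids_cone n m \<alpha> (\<lambda>p. H p \<omega>)" for \<omega>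
      by (rule avoids_cone_cong) (simp add: X_def J_def)
    moreover have "X \<omega> \<in> space (std_normals J)" for \<omega>
      by (simp add: X_def space_PiM)
    ultimately show ?thesis by auto
  qed
  finally have 1: "measure (std_normals J) (?G J) = measure M {\<omega> \<in> space M. avoids_cone n m \<alpha> (\<lambda>p. H p \<omega>)}" .
  \<comment> \<open>Restricting the coordinates to the block forgets the last row, the last column
    and the corner.\<close>
  have dI: "distr (std_normals I) (std_normals J) (\<lambda>x. \<lambda>p\<in>J. x p) = std_normals J"
    using distr_PiM_reindex[of I "\<lambda>_. std_normal" "\<lambda>p. p" J] JI prob_space_std_normal by auto
  have mI: "(\<lambda>x. \<lambda>p\<in>J. x p) \<in> measurable (std_normals I) (std_normals J)"
    by (rule measurable_restrict) (use JI in \<open>auto intro: measurable_component_singleton\<close>)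
  have "measure (std_normals J) (?G J) = measure (distr (std_normals I) (std_normals J) (\<lambda>x. \<lambda>p\<in>J. x p)) (?G J)"
    by (simp add: dI)
  also have "\<dots> = measure (std_normals I) ((\<lambda>x. \<lambda>p\<in>J. x p) -` ?G J \<inter> space (std_normals I))"
    by (rule measure_distr[OF mI GJ])
  also have "(\<lambda>x. \<lambda>p\<in>J. x p) -` ?G J \<inter> space (std_normals I) = ?G I"
  proof -
    have "avoids_cone n m \<alpha> (\<lambda>p\<in>J. x p) \<longleftrightarrow> avoids_cone n m \<alpha> x" for x
      by (rule avoids_cone_cong) (simp add: J_def)
    moreover have "(\<lambda>p\<in>J. x p) \<in> space (std_normals J)" for x :: "nat \<times> nat \<Rightarrow> real"
      by (simp add: space_PiM)
    ultimately show ?thesis by auto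
  qed
  finally show ?thesis unfolding avoids_cone_column_space[symmetric] I_def[symmetric] 1[symmetric] .
qed

text \<open>Every dimension has its own probability space, as only the law of each matrix enters.
  The width bound survives at \<open>alpha_star\<close> itself and is stated there too; what rests
  on the strict inequality is claimed for each \<alpha> that satisfies it.\<close>

theorem mainTheorem2:
  fixes \<delta> :: real
    and n m :: "nat \<Rightarrow> nat"
    and M :: "nat \<Rightarrow> 'a measure"
    and H :: "nat \<Rightarrow> nat \<times> nat \<Rightarrow> 'a \<Rightarrow> real"
  assumes n_lim: "filterlim n at_top sequentially"
    and m_bounds: "\<And>k. 0 < m k \<and> m k < n k"
    and ratio: "\<And>k. real (m k) / real (n k) = \<delta>"
    and gauss: "\<And>k. gaussian_matrix (M k) (n k) (m k) (H k)"
  shows "0 < alpha_star \<delta>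
    \<and> (\<forall>\<alpha>>0. g_fun \<alpha> < sqrt (1 - \<delta>) \<longleftrightarrow> \<alpha> < alpha_star \<delta>)
    \<and> (\<forall>\<^sub>F k in sequentially.
          gaussian_width (n k) (S_set (n k) (alpha_star \<delta>))
            \<le> g_fun (alpha_star \<delta>) * sqrt (real (n k)))
    \<and> (\<forall>\<alpha>>0. g_fun \<alpha> < sqrt (1 - \<delta>) \<longrightarrow>
        (\<forall>\<^sub>F k in sequentially.
            gaussian_width (n k) (S_set (n k) \<alpha>) \<le> g_fun \<alpha> * sqrt (real (n k))
          \<and> g_fun \<alpha> * sqrt (real (n k))
              < sqrt (real (n k) - real (m k)) - 1 / (2 * sqrt (real (n k) - real (m k))))
      \<and> (\<lambda>k. measure (M k) {\<omega> \<in> space (M k).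
            \<forall>w\<in>column_space (n k) (m k) (\<lambda>p. H k p \<omega>).
              l1_norm (n k) w \<ge> \<alpha> * sqrt (real (n k)) * L2_set w {..<n k}})
          \<longlonglongrightarrow> 1)"
proof -
  have n0: "0 < n k" for k using m_bounds[of k] by simp
  have \<delta>: "0 < \<delta>" "\<delta> < 1"
    unfolding ratio[of 0, symmetric] using m_bounds[of 0] by simp_all
  have mn: "real (m k) = \<delta> * real (n k)" for k
    using ratio[of k] n0[of k] by (auto simp: field_simps)
  have n_real: "filterlim (\<lambda>k. real (n k)) at_top sequentially"
    by (rule filterlim_compose[OF filterlim_real_sequentially n_lim])
  have width: "\<forall>\<^sub>F k in sequentially. gaussian_width (n k) (S_set (n k) \<alpha>) \<le> g_fun \<alpha> * sqrt (real (n k))"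
    if \<alpha>: "0 < \<alpha>" for \<alpha>
  proof -
    have "\<forall>\<^sub>F k in sequentially. (1 / \<alpha>)\<^sup>2 < real (n k)"
      using n_real by (simp add: filterlim_at_top_dense)
    then show ?thesis
    proof eventually_elim
      case (elim k)
      then have "1 / \<alpha> < sqrt (real (n k))" by (rule real_less_rsqrt)
      then have "1 < \<alpha> * sqrt (real (n k))" using \<alpha> by (simp add: field_simps)
      then show ?case by (rule gaussian_width_le[OF \<alpha> n0])
    qed
  qed
  have strict: "\<forall>\<^sub>F k in sequentially. g * sqrt (real (n k))
      < sqrt (real (n k) - real (m k)) - 1 / (2 * sqrt (real (n k) - real (m k)))"
    if g: "g < sqrt (1 - \<delta>)" for g
  proof -
    \<comment> \<open>Here sqrt (n - m) = s sqrt n. The correction 1 / (2 s sqrt n) is smaller than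
      the gap (s - g) sqrt n exactly when n > 1 / (2 s (s - g)).\<close>
    define s where "s = sqrt (1 - \<delta>)"
    have s: "0 < s" "g < s" using \<delta> g by (simp_all add: s_def)
    have "\<forall>\<^sub>F k in sequentially. 1 / (2 * s * (s - g)) < real (n k)"
      using n_real by (simp add: filterlim_at_top_dense)
    then show ?thesis
    proof eventually_elim
      case (elim k)
      define r where "r = sqrt (real (n k))"
      have r: "0 < r" "real (n k) = r * r" using n0[of k] by (simp_all add: r_def)
      have "real (n k) - real (m k) = (1 - \<delta>) * real (n k)" by (simp add: mn algebra_simps)
      then have eq: "sqrt (real (n k) - real (m k)) = s * r" by (simp add: real_sqrt_mult s_def r_def)
      have "1 < 2 * s * (s - g) * (r * r)"
        using elim s by (simp add: r(2) field_simps)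
      then have "1 / (2 * (s * r)) < (s - g) * r"
        using s r by (simp add: field_simps)
      then show ?case unfolding eq r_def[symmetric] by (simp add: algebra_simps)
    qed
  qed
  have prob: "(\<lambda>k. measure (M k) {\<omega> \<in> space (M k).
      \<forall>w\<in>column_space (n k) (m k) (\<lambda>p. H k p \<omega>).
        l1_norm (n k) w \<ge> \<alpha> * sqrt (real (n k)) * L2_set w {..<n k}}) \<longlonglongrightarrow> 1" (is "?p \<longlonglongrightarrow> 1")
    if \<alpha>: "0 < \<alpha>" "g_fun \<alpha> < sqrt (1 - \<delta>)" for \<alpha>
  proof -
    obtain u where u: "0 \<le> u" "g_fun \<alpha> = g_obj \<alpha> u" using g_fun_minimum[OF \<alpha>(1)] by metis
    have gap: "sqrt (shrink_moment u) + \<alpha> * u < sqrt (1 - \<delta>)"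
      using \<alpha>(2) u by (simp add: g_obj_eq)
    obtain K where K: "\<And>n m. 0 < n \<Longrightarrow> real m = \<delta> * real n \<Longrightarrow>
        1 - K / real n \<le> measure (std_normals ({..n} \<times> {..m}))
          {x \<in> space (std_normals ({..n} \<times> {..m})). avoids_cone n m \<alpha> x}"
      using avoids_cone_probability[OF \<alpha>(1) u(1) \<delta> gap] by blast
    show ?thesis
    proof (rule real_tendsto_sandwich)
      show "\<forall>\<^sub>F k in sequentially. 1 - K / real (n k) \<le> ?p k"
        unfolding gaussian_matrix_avoids_cone[OF gauss n0 conjunct1[OF m_bounds]]
        by (intro always_eventually allI K n0 mn)
      show "\<forall>\<^sub>F k in sequentially. ?p k \<le> 1"
        using gauss by (intro always_eventually allI prob_space.prob_le_1) (simp add: gaussian_matrix_def)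
      have "(\<lambda>k. K / real (n k)) \<longlonglongrightarrow> 0"
        by (rule real_tendsto_divide_at_top[OF tendsto_const n_real])
      then show "(\<lambda>k. 1 - K / real (n k)) \<longlonglongrightarrow> 1"
        using tendsto_diff[OF tendsto_const[of "1 :: real"]] by fastforce
    qed simp
  qed
  show ?thesis
    using alpha_star_properties[OF \<delta>] width[OF alpha_star_properties(1)[OF \<delta>]]
    by (intro conjI allI impI eventually_conj width strict prob) simp_all
qed

end
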